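(* Let $\mathcal{S}_2$ be the set of two-qubit pure states shared by Alice and Bob of the form $|\psi_S\rangle_{AB}=\alpha|00\rangle_{AB}+\beta|11\rangle_{AB}$ with $\alpha,\beta\in\mathbb{C}$, $|\alpha|^2+|\beta|^2=1$, and let $n=2$. The optimal universal conclusive ECP over $\mathcal{S}_2$ for two copies transforms $\psi_S^{\otimes 2}$ into $\phi^+$ with (optimal) success probability $$P_{\psi_S^{\otimes 2}\to\phi^+}=2|\alpha\beta|^2 .$$ That is, the optimal universal conclusive ECP $\mathcal{E}_1^{\text{optimal}}$ satisfies $\operatorname{Tr}[\mathcal{E}_1^{\text{optimal}}(\psi_S^{\otimes 2})]=2|\alpha\beta|^2$ for every $|\psi_S\rangle\in\mathcal{S}_2$.
   Context: For a pure state $|\psi\rangle$ write $\psi=|\psi\rangle\langle\psi|$. $|\phi^+\rangle=(|00\rangle+|11\rangle)/\sqrt2$. Copies of the state are shared between Alice (systems $A,A',\dots$) and Bob (systems $B,B',\dots$); locality is with respect to the Alice/Bob cut. LOCC means local operations and classical communication. Let $\mathcal{E}_1,\mathcal{E}_2$ be completely positive trace non-increasing LOCC maps such that $\mathcal{E}_1+\mathcal{E}_2$ is trace preserving; $\mathcal{E}_1$ is the success branch. It takes $n$ copies of a two-qubit state to a single two-qubit state (any residual "garbage" systems are discarded). Universal conclusive ECP (entanglement concentration protocol): given a set $\mathcal{S}$ of states shared by Alice and Bob and a number of copies $n$, the $n$-to-$1$ map $\mathcal{E}_1$ is a universal conclusive ECP (over $\mathcal{S}$) if for every $\rho\in\mathcal{S}$,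 $\langle\phi^+|\mathcal{E}_1(\rho^{\otimes n})|\phi^+\rangle=\operatorname{Tr}[\mathcal{E}_1(\rho^{\otimes n})]$. Optimal universal conclusive ECP: a universal conclusive ECP $\mathcal{E}_1^{\text{optimal}}$ (over $\mathcal{S}$, for $n$ copies) such that for every $\rho\in\mathcal{S}$ and every universal conclusive ECP $\mathcal{E}_1$ (over $\mathcal{S}$, for $n$ copies), $\operatorname{Tr}[\mathcal{E}_1(\rho^{\otimes n})]\le\operatorname{Tr}[\mathcal{E}_1^{\text{optimal}}(\rho^{\otimes n})]$. *)

theory Defs
  imports "Jordan_Normal_Form.Schur_Decomposition"
begin

text \<open>
  A bipartite system with local dimensions \<open>a\<close> (Alice) and \<open>b\<close> (Bob) is \<open>complex mat\<close> of size
  \<open>a * b\<close>; the product basis vector with local labels \<open>x < a\<close> and \<open>y < b\<close> has index \<open>x * b + y\<close>.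
\<close>

definition mtrace :: "complex mat \<Rightarrow> complex" where
  "mtrace A = (\<Sum>i<dim_row A. A $$ (i, i))"

text \<open>The dimension argument gives the value of the empty sum.\<close>

definition mat_sum :: "nat \<Rightarrow> complex mat list \<Rightarrow> complex mat" where
  "mat_sum d As = foldr (+) As (0\<^sub>m d d)"

definition kron :: "complex mat \<Rightarrow> complex mat \<Rightarrow> complex mat" where
  "kron A B = mat (dim_row A * dim_row B) (dim_col A * dim_col B)
     (\<lambda>(i, j). A $$ (i div dim_row B, j div dim_col B) * B $$ (i mod dim_row B, j mod dim_col B))"

text \<open>The order on \<open>complex\<close> is the one in which \<open>0 \<le> z\<close> says that \<open>z\<close> is real and nonnegative.\<close>

definition psd :: "nat \<Rightarrow> complex mat \<Rightarrow> bool" where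
  "psd d A \<longleftrightarrow> A \<in> carrier_mat d d \<and> (\<forall>v \<in> carrier_vec d. 0 \<le> (A *\<^sub>v v) \<bullet>c v)"


section \<open>Maps on operators\<close>

text \<open>
  A map from operators on a \<open>d\<close>-dimensional space to operators on a \<open>d'\<close>-dimensional one is a HOL
  function of which only the values on \<open>carrier_mat d d\<close> matter.
\<close>

definition linear_super :: "nat \<Rightarrow> nat \<Rightarrow> (complex mat \<Rightarrow> complex mat) \<Rightarrow> bool" where
  "linear_super d d' E \<longleftrightarrow>
     (\<forall>X \<in> carrier_mat d d. E X \<in> carrier_mat d' d') \<and>
     (\<forall>X \<in> carrier_mat d d. \<forall>Y \<in> carrier_mat d d. E (X + Y) = E X + E Y) \<and>
     (\<forall>c. \<forall>X \<in> carrier_mat d d. E (c \<cdot>\<^sub>m X) = c \<cdot>\<^sub>m E X)"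

text \<open>\<open>ampliation k d d' E\<close> is \<open>id \<otimes> E\<close> with a \<open>k\<close>-dimensional reference: \<open>E\<close> acts on each \<open>d \<times> d\<close> block.\<close>

definition ampliation ::
    "nat \<Rightarrow> nat \<Rightarrow> nat \<Rightarrow> (complex mat \<Rightarrow> complex mat) \<Rightarrow> complex mat \<Rightarrow> complex mat" where
  "ampliation k d d' E X = mat (k * d') (k * d')
     (\<lambda>(i, j). E (mat d d (\<lambda>(r, c). X $$ ((i div d') * d + r, (j div d') * d + c))) $$ (i mod d', j mod d'))"

definition completely_positive :: "nat \<Rightarrow> nat \<Rightarrow> (complex mat \<Rightarrow> complex mat) \<Rightarrow> bool" where
  "completely_positive d d' E \<longleftrightarrow>
     linear_super d d' E \<and> (\<forall>k X. psd (k * d) X \<longrightarrow> psd (k * d') (ampliation k d d' E X))"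

definition trace_nonincreasing :: "nat \<Rightarrow> (complex mat \<Rightarrow> complex mat) \<Rightarrow> bool" where
  "trace_nonincreasing d E \<longleftrightarrow> (\<forall>X. psd d X \<longrightarrow> mtrace (E X) \<le> mtrace X)"

definition trace_preserving :: "nat \<Rightarrow> (complex mat \<Rightarrow> complex mat) \<Rightarrow> bool" where
  "trace_preserving d E \<longleftrightarrow> (\<forall>X \<in> carrier_mat d d. mtrace (E X) = mtrace X)"


section \<open>LOCC\<close>

definition kraus_map :: "nat \<Rightarrow> complex mat list \<Rightarrow> complex mat \<Rightarrow> complex mat" where
  "kraus_map d' Ks X = mat_sum d' (map (\<lambda>K. K * X * mat_adjoint K) Ks)"

text \<open>
  A local quantum instrument on a \<open>d\<close>-dimensional system. Each outcome is a pair of the dimension of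
  the system after that outcome and the Kraus operators of the associated completely positive map.
  The maps of all outcomes add up to a trace-preserving one. The output dimension is free, so
  adjoining ancillas and discarding subsystems are special cases.
\<close>

definition local_instrument :: "nat \<Rightarrow> (nat \<times> complex mat list) list \<Rightarrow> bool" where
  "local_instrument d ops \<longleftrightarrow>
     (\<forall>(d', Ks) \<in> set ops. set Ks \<subseteq> carrier_mat d' d) \<and>
     mat_sum d (map (\<lambda>K. mat_adjoint K * K) (concat (map snd ops))) = 1\<^sub>m d"

text \<open>
  \<open>locc_instrument a' b' a b Fs\<close>: the list \<open>Fs\<close> consists of the maps (from operators on the
  \<open>a\<close>-by-\<open>b\<close> system to operators on the \<open>a'\<close>-by-\<open>b'\<close> system) that belong to the possible complete
  classical transcripts of a finite-round LOCC protocol. In each round one party applies a local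
  instrument and announces the outcome; the remaining protocol may depend on everything announced.
\<close>

inductive locc_instrument ::
    "nat \<Rightarrow> nat \<Rightarrow> nat \<Rightarrow> nat \<Rightarrow> (complex mat \<Rightarrow> complex mat) list \<Rightarrow> bool"
  for a' b' where
  finish: "locc_instrument a' b' a' b' [\<lambda>X. X]"
| alice: "local_instrument a ops \<Longrightarrow>
    list_all2 (\<lambda>p Fs. locc_instrument a' b' (fst p) b Fs) ops Fss \<Longrightarrow>
    locc_instrument a' b' a b
      (concat (map (\<lambda>((d, Ks), Fs).
          map (\<lambda>F X. F (kraus_map (d * b) (map (\<lambda>K. kron K (1\<^sub>m b)) Ks) X)) Fs) (zip ops Fss)))"
| bob: "local_instrument b ops \<Longrightarrow>
    list_all2 (\<lambda>p Fs. locc_instrument a' b' a (fst p) Fs) ops Fss \<Longrightarrow>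
    locc_instrument a' b' a b
      (concat (map (\<lambda>((d, Ks), Fs).
          map (\<lambda>F X. F (kraus_map (a * d) (map (\<lambda>K. kron (1\<^sub>m a) K) Ks) X)) Fs) (zip ops Fss)))"

text \<open>Two-outcome LOCC instrument: the transcripts (positions in \<open>Fs\<close>) are split into two classes.\<close>

definition locc_pair ::
    "nat \<Rightarrow> nat \<Rightarrow> nat \<Rightarrow> nat \<Rightarrow> (complex mat \<Rightarrow> complex mat) \<Rightarrow> (complex mat \<Rightarrow> complex mat) \<Rightarrow> bool" where
  "locc_pair a b a' b' E1 E2 \<longleftrightarrow>
     (\<exists>Fs I. locc_instrument a' b' a b Fs \<and>
        (\<forall>X \<in> carrier_mat (a * b) (a * b).
           E1 X = mat_sum (a' * b') (map (\<lambda>F. F X) (nths Fs I)) \<and>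
           E2 X = mat_sum (a' * b') (map (\<lambda>F. F X) (nths Fs (- I)))))"


section \<open>Two-qubit states\<close>

definition ket2 :: "nat \<Rightarrow> nat \<Rightarrow> complex vec" where
  "ket2 x y = unit_vec 4 (2 * x + y)"

definition proj :: "complex vec \<Rightarrow> complex mat" where
  "proj v = mat (dim_vec v) (dim_vec v) (\<lambda>(i, j). v $ i * cnj (v $ j))"

definition phi_plus :: "complex vec" where
  "phi_plus = complex_of_real (1 / sqrt 2) \<cdot>\<^sub>v (ket2 0 0 + ket2 1 1)"

definition psi_S :: "complex \<Rightarrow> complex \<Rightarrow> complex vec" where
  "psi_S \<alpha> \<beta> = \<alpha> \<cdot>\<^sub>v ket2 0 0 + \<beta> \<cdot>\<^sub>v ket2 1 1"

definition S2 :: "complex mat set" where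
  "S2 = {proj (psi_S \<alpha> \<beta>) | \<alpha> \<beta>. (cmod \<alpha>)\<^sup>2 + (cmod \<beta>)\<^sup>2 = 1}"

text \<open>
  \<open>n\<close> copies of a two-qubit operator, with the tensor factors reordered so that Alice's \<open>n\<close> qubits
  come first and Bob's \<open>n\<close> qubits second. The qubit of copy \<open>k\<close> is the \<open>k\<close>-th binary digit of the
  respective local label.
\<close>

definition bin_digit :: "nat \<Rightarrow> nat \<Rightarrow> nat" where
  "bin_digit k x = (x div 2 ^ k) mod 2"

definition copy_index :: "nat \<Rightarrow> nat \<Rightarrow> nat \<Rightarrow> nat" where
  "copy_index n k i = 2 * bin_digit k (i div 2 ^ n) + bin_digit k (i mod 2 ^ n)"

definition copies :: "nat \<Rightarrow> complex mat \<Rightarrow> complex mat" where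
  "copies n \<rho> = mat (2 ^ n * 2 ^ n) (2 ^ n * 2 ^ n)
     (\<lambda>(i, j). \<Prod>k<n. \<rho> $$ (copy_index n k i, copy_index n k j))"


section \<open>Universal conclusive entanglement concentration\<close>

text \<open>\<open>E2\<close> is the failure branch.\<close>

definition universal_conclusive_ECP ::
    "complex mat set \<Rightarrow> nat \<Rightarrow> (complex mat \<Rightarrow> complex mat) \<Rightarrow> bool" where
  "universal_conclusive_ECP S n E1 \<longleftrightarrow>
     (\<exists>E2. locc_pair (2 ^ n) (2 ^ n) 2 2 E1 E2 \<and>
        completely_positive (2 ^ n * 2 ^ n) (2 * 2) E1 \<and> trace_nonincreasing (2 ^ n * 2 ^ n) E1 \<and>
        completely_positive (2 ^ n * 2 ^ n) (2 * 2) E2 \<and> trace_nonincreasing (2 ^ n * 2 ^ n) E2 \<and>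
        trace_preserving (2 ^ n * 2 ^ n) (\<lambda>X. E1 X + E2 X)) \<and>
     (\<forall>\<rho> \<in> S. (E1 (copies n \<rho>) *\<^sub>v phi_plus) \<bullet>c phi_plus = mtrace (E1 (copies n \<rho>)))"

definition optimal_universal_conclusive_ECP ::
    "complex mat set \<Rightarrow> nat \<Rightarrow> (complex mat \<Rightarrow> complex mat) \<Rightarrow> bool" where
  "optimal_universal_conclusive_ECP S n Eopt \<longleftrightarrow>
     universal_conclusive_ECP S n Eopt \<and>
     (\<forall>\<rho> \<in> S. \<forall>E1. universal_conclusive_ECP S n E1 \<longrightarrow>
        mtrace (E1 (copies n \<rho>)) \<le> mtrace (Eopt (copies n \<rho>)))"

end

theory Submission
  imports Defs
begin

text \<open>
  Every branch of an LOCC protocol has Kraus operators of product form \<open>K = A \<otimes> B\<close>, and a conclusive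
  protocol sends each two-copy state to a multiple of \<open>\<phi>\<^sup>+\<close> under every single \<open>K\<close>. For the
  product states \<open>|00,00\<rangle>\<close> and \<open>|11,11\<rangle>\<close> the image is also a product vector, hence zero. So only
  the component \<open>\<alpha>\<beta> (|01,01\<rangle> + |10,10\<rangle>)\<close> of \<open>\<psi>\<^sub>S \<otimes> \<psi>\<^sub>S\<close> contributes, and since the protocol does
  not increase the trace its success probability is at most \<open>2|\<alpha>\<beta>|\<^sup>2\<close>, the squared norm of that
  component. Projecting onto the odd-parity subspace on both sides attains this bound.
\<close>

text \<open>Locality enters the upper bound only through the product form of the Kraus operators. It
  cannot be dropped: discarding the input and preparing phi+ globally would succeed with certainty.
  Conclusiveness is a condition on a sum over Kraus operators. It passes to the single ones because
  the weight outside phi+ is additive and, on a pure state, a sum of squares. Trace monotonicity at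
  a normalised two-copy state gives merely the bound 1. It has to be applied to the unnormalised
  vector |01,01> + |10,10>, which is not of the form psi (x) psi, so the values of the map on
  \<open>S2\<close> alone do not suffice and its action is derived from the Kraus operators. This
  yields one number \<open>p\<close> for all \<alpha>, \<beta>. Optimality asks for a single map
  that is best at every state simultaneously, and such a map exists because competitors differ on
  these inputs only in \<open>p\<close>, which the parity protocol makes equal to 1.\<close>

section \<open>Index arithmetic for product bases and entries of matrix products\<close>

lemma sum_div_mod:
  fixes f :: "nat \<Rightarrow> nat \<Rightarrow> 'a::comm_monoid_add"
  shows "(\<Sum>k<m * n. f (k div n) (k mod n)) = (\<Sum>i<m. \<Sum>j<n. f i j)"
proof -
  have "(\<Sum>k=i * n..<i * n + n. f (k div n) (k mod n)) = (\<Sum>j<n. f i j)" for i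
  proof -
    have "(\<Sum>k=i * n..<i * n + n. f (k div n) (k mod n))
        = (\<Sum>k=0..<n. f ((k + i * n) div n) ((k + i * n) mod n))"
      using sum.shift_bounds_nat_ivl[of "\<lambda>k. f (k div n) (k mod n)" 0 "i * n" n]
      by (simp add: add.commute)
    also have "\<dots> = (\<Sum>j<n. f i j)"
      by (rule sum.cong) auto
    finally show ?thesis .
  qed
  then show ?thesis
    by (simp add: sum.nat_group[symmetric])
qed

lemma mult_mat_index:
  assumes "A \<in> carrier_mat m n" "B \<in> carrier_mat n p" "i < m" "j < p"
  shows "(A * B) $$ (i, j) = (\<Sum>k<n. A $$ (i, k) * B $$ (k, j))"
  using assms by (auto simp: scalar_prod_def atLeast0LessThan intro!: sum.cong)

lemma mult_mat_vec_index:
  assumes "A \<in> carrier_mat m n" "v \<in> carrier_vec n" "i < m"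
  shows "(A *\<^sub>v v) $ i = (\<Sum>k<n. A $$ (i, k) * v $ k)"
  using assms by (auto simp: scalar_prod_def atLeast0LessThan intro!: sum.cong)

lemma div_mod_less:
  assumes "i < a * (b::nat)"
  shows "i div b < a" "i mod b < b"
proof -
  have "b > 0" using assms by (cases b) auto
  then show "i div b < a" "i mod b < b"
    using assms by (auto simp: less_mult_imp_div_less)
qed

section \<open>Adjoints and Kronecker products\<close>

lemma mat_adjoint_carrier [simp]: "A \<in> carrier_mat m n \<Longrightarrow> mat_adjoint A \<in> carrier_mat n m"
  unfolding mat_adjoint_def by (auto simp: mat_of_rows_def)

lemma mat_adjoint_index:
  fixes A :: "complex mat"
  assumes "A \<in> carrier_mat m n" "i < n" "j < m"
  shows "mat_adjoint A $$ (i, j) = cnj (A $$ (j, i))"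
  using assms unfolding mat_adjoint_def by (auto simp: mat_of_rows_def)

lemma mat_adjoint_mult:
  fixes A :: "complex mat"
  assumes "A \<in> carrier_mat m n" "B \<in> carrier_mat n p"
  shows "mat_adjoint (A * B) = mat_adjoint B * mat_adjoint A"
proof (rule eq_matI)
  have AB: "A * B \<in> carrier_mat m p" using assms by auto
  have ad: "mat_adjoint B * mat_adjoint A \<in> carrier_mat p m" using assms by (meson mat_adjoint_carrier mult_carrier_mat)
  fix i j assume "i < dim_row (mat_adjoint B * mat_adjoint A)"
    "j < dim_col (mat_adjoint B * mat_adjoint A)"
  then have ij: "i < p" "j < m" using ad by auto
  have "mat_adjoint (A * B) $$ (i, j) = (\<Sum>k<n. cnj (A $$ (j, k)) * cnj (B $$ (k, i)))"
    using ij by (simp add: mat_adjoint_index[OF AB] mult_mat_index[OF assms])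
  also have "\<dots> = (\<Sum>k<n. mat_adjoint B $$ (i, k) * mat_adjoint A $$ (k, j))"
    using ij assms by (intro sum.cong) (simp_all add: mat_adjoint_index[of _ n p] mat_adjoint_index[of _ m n])
  also have "\<dots> = (mat_adjoint B * mat_adjoint A) $$ (i, j)"
    using ij assms by (intro mult_mat_index[symmetric, of _ p n _ m]) auto
  finally show "mat_adjoint (A * B) $$ (i, j) = (mat_adjoint B * mat_adjoint A) $$ (i, j)" .
next
  have "A * B \<in> carrier_mat m p" using assms by auto
  then show "dim_row (mat_adjoint (A * B)) = dim_row (mat_adjoint B * mat_adjoint A)"
    "dim_col (mat_adjoint (A * B)) = dim_col (mat_adjoint B * mat_adjoint A)"
    using assms mat_adjoint_carrier[of "A * B" m p] mat_adjoint_carrier[of B n p]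
      mat_adjoint_carrier[of A m n]
    by (auto simp del: mat_adjoint_carrier)
qed

lemma kron_carrier [simp]:
  "A \<in> carrier_mat a' a \<Longrightarrow> B \<in> carrier_mat b' b \<Longrightarrow> kron A B \<in> carrier_mat (a' * b') (a * b)"
  unfolding kron_def by auto

lemma kron_index:
  assumes "A \<in> carrier_mat a' a" "B \<in> carrier_mat b' b" "i < a' * b'" "j < a * b"
  shows "kron A B $$ (i, j) = A $$ (i div b', j div b) * B $$ (i mod b', j mod b)"
  using assms unfolding kron_def by auto

lemma kron_mult:
  assumes "A \<in> carrier_mat a' a" "B \<in> carrier_mat b' b"
    and "C \<in> carrier_mat a c" "D \<in> carrier_mat b d"
  shows "kron A B * kron C D = kron (A * C) (B * D)"
proof (rule eq_matI)
  fix i j assume "i < dim_row (kron (A * C) (B * D))" "j < dim_col (kron (A * C) (B * D))"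
  then have ij: "i < a' * b'" "j < c * d" using assms by (auto simp: kron_def)
  note ij' = div_mod_less[OF ij(1)] div_mod_less[OF ij(2)]
  have "(kron A B * kron C D) $$ (i, j) = (\<Sum>k<a * b. kron A B $$ (i, k) * kron C D $$ (k, j))"
    using assms ij by (intro mult_mat_index) auto
  \<comment> \<open>Written as a function of the two digits of \<open>k\<close>, the summand fits
    \<open>sum_div_mod\<close>, and the resulting double sum factorises.\<close>
  also have "\<dots> = (\<Sum>k<a * b. (\<lambda>x y. A $$ (i div b', x) * C $$ (x, j div d) *
      (B $$ (i mod b', y) * D $$ (y, j mod d))) (k div b) (k mod b))"
    using ij by (intro sum.cong)
      (auto simp: kron_index[OF assms(1,2)] kron_index[OF assms(3,4)])
  also have "\<dots> = (A * C) $$ (i div b', j div d) * (B * D) $$ (i mod b', j mod d)"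
    using ij' by (subst sum_div_mod)
      (simp add: mult_mat_index[OF assms(1,3)] mult_mat_index[OF assms(2,4)] sum_product)
  also have "\<dots> = kron (A * C) (B * D) $$ (i, j)"
    using assms ij by (intro kron_index[symmetric]) auto
  finally show "(kron A B * kron C D) $$ (i, j) = kron (A * C) (B * D) $$ (i, j)" .
qed (use assms in \<open>auto simp: kron_def\<close>)

lemma mat_adjoint_kron:
  assumes "A \<in> carrier_mat a' a" "B \<in> carrier_mat b' b"
  shows "mat_adjoint (kron A B) = kron (mat_adjoint A) (mat_adjoint B)"
proof (rule eq_matI)
  have ad: "kron (mat_adjoint A) (mat_adjoint B) \<in> carrier_mat (a * b) (a' * b')"
    "mat_adjoint (kron A B) \<in> carrier_mat (a * b) (a' * b')"
    using assms by auto
  show "dim_row (mat_adjoint (kron A B)) = dim_row (kron (mat_adjoint A) (mat_adjoint B))"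
    "dim_col (mat_adjoint (kron A B)) = dim_col (kron (mat_adjoint A) (mat_adjoint B))"
    using ad by auto
  fix i j assume "i < dim_row (kron (mat_adjoint A) (mat_adjoint B))"
    "j < dim_col (kron (mat_adjoint A) (mat_adjoint B))"
  then have ij: "i < a * b" "j < a' * b'" using ad by auto
  note ij' = div_mod_less[OF ij(1)] div_mod_less[OF ij(2)]
  show "mat_adjoint (kron A B) $$ (i, j) = kron (mat_adjoint A) (mat_adjoint B) $$ (i, j)"
    using ij ij' assms
    by (simp add: kron_index[of _ a a' _ b b'] mat_adjoint_index[of _ "a' * b'" "a * b"]
        kron_index[OF assms] mat_adjoint_index[of _ a' a] mat_adjoint_index[of _ b' b])
qed

lemma mat_adjoint_one [simp]: "mat_adjoint (1\<^sub>m n) = (1\<^sub>m n :: complex mat)"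
proof (rule eq_matI)
  have "mat_adjoint (1\<^sub>m n :: complex mat) \<in> carrier_mat n n" by (rule mat_adjoint_carrier) simp
  note this[THEN carrier_matD(1)] this[THEN carrier_matD(2)]
  then show "dim_row (mat_adjoint (1\<^sub>m n :: complex mat)) = dim_row (1\<^sub>m n :: complex mat)"
    "dim_col (mat_adjoint (1\<^sub>m n :: complex mat)) = dim_col (1\<^sub>m n :: complex mat)"
    by simp_all
qed (auto simp: mat_adjoint_index[OF one_carrier_mat])

lemma kron_one [simp]: "kron (1\<^sub>m a) (1\<^sub>m b) = 1\<^sub>m (a * b)"
proof (rule eq_matI)
  fix i j assume "i < dim_row (1\<^sub>m (a * b))" "j < dim_col (1\<^sub>m (a * b))"
  then have ij: "i < a * b" "j < a * b" by auto
  note ij' = div_mod_less[OF ij(1)] div_mod_less[OF ij(2)]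
  have "i = j \<longleftrightarrow> i div b = j div b \<and> i mod b = j mod b"
    by (metis div_mult_mod_eq)
  with ij ij' show "kron (1\<^sub>m a) (1\<^sub>m b) $$ (i, j) = 1\<^sub>m (a * b) $$ (i, j)"
    by (auto simp: kron_def)
qed (auto simp: kron_def)

section \<open>Sums and traces\<close>

lemma mat_sum_Nil [simp]: "mat_sum d [] = 0\<^sub>m d d"
  and mat_sum_Cons [simp]: "mat_sum d (A # As) = A + mat_sum d As"
  by (simp_all add: mat_sum_def)

lemma mat_sum_carrier [simp]: "set As \<subseteq> carrier_mat d d \<Longrightarrow> mat_sum d As \<in> carrier_mat d d"
  by (induction As) auto

lemma mat_sum_index:
  "set As \<subseteq> carrier_mat d d \<Longrightarrow> i < d \<Longrightarrow> j < d \<Longrightarrow>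
    mat_sum d As $$ (i, j) = (\<Sum>A\<leftarrow>As. A $$ (i, j))"
proof (induction As)
  case (Cons A As)
  then have "mat_sum d As \<in> carrier_mat d d" by simp
  note this[THEN carrier_matD(1)] this[THEN carrier_matD(2)]
  with Cons show ?case by simp
qed simp

text \<open>Stated for any additive functional so that it covers the trace, the pairing with a fixed
  state in \<open>local_instrument_trace\<close>, and \<open>defect\<close>.\<close>

lemma mat_sum_additive:
  assumes "f (0\<^sub>m d d) = (0::'a::comm_monoid_add)"
    and "\<And>A B. A \<in> carrier_mat d d \<Longrightarrow> B \<in> carrier_mat d d \<Longrightarrow> f (A + B) = f A + f B"
    and "set As \<subseteq> carrier_mat d d"
  shows "f (mat_sum d As) = (\<Sum>A\<leftarrow>As. f A)"
  using assms(3) by (induction As) (auto simp: assms(1,2))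

lemma mat_sum_hom:
  assumes "f (0\<^sub>m d d) = 0\<^sub>m d' d'"
    and "\<And>A B. A \<in> carrier_mat d d \<Longrightarrow> B \<in> carrier_mat d d \<Longrightarrow> f (A + B) = f A + f B"
    and "set As \<subseteq> carrier_mat d d"
  shows "f (mat_sum d As) = mat_sum d' (map f As)"
  using assms(3) by (induction As) (auto simp: assms(1,2))

lemma mat_sum_append:
  assumes "set As \<subseteq> carrier_mat d d" "set Bs \<subseteq> carrier_mat d d"
  shows "mat_sum d (As @ Bs) = mat_sum d As + mat_sum d Bs"
  using assms by (induction As) (auto simp: assoc_add_mat[of _ d d])

lemma mtrace_add:
  "A \<in> carrier_mat d d \<Longrightarrow> B \<in> carrier_mat d d \<Longrightarrow> mtrace (A + B) = mtrace A + mtrace B"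
  by (auto simp: mtrace_def sum.distrib)

lemma mtrace_smult: "A \<in> carrier_mat d d \<Longrightarrow> mtrace (c \<cdot>\<^sub>m A) = c * mtrace A"
  by (auto simp: mtrace_def sum_distrib_left)

lemma mtrace_zero [simp]: "mtrace (0\<^sub>m d d) = 0"
  by (auto simp: mtrace_def)

lemma mtrace_mat_sum: "set As \<subseteq> carrier_mat d d \<Longrightarrow> mtrace (mat_sum d As) = (\<Sum>A\<leftarrow>As. mtrace A)"
  by (rule mat_sum_additive) (auto simp: mtrace_add)

lemma mtrace_comm:
  assumes "A \<in> carrier_mat m n" "B \<in> carrier_mat n m"
  shows "mtrace (A * B) = mtrace (B * A)"
proof -
  have "mtrace (A * B) = (\<Sum>i<m. \<Sum>k<n. A $$ (i, k) * B $$ (k, i))"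
    using assms(1) by (simp add: mtrace_def mult_mat_index[OF assms])
  also have "\<dots> = (\<Sum>k<n. \<Sum>i<m. B $$ (k, i) * A $$ (i, k))"
    by (subst sum.swap) (simp add: mult.commute)
  also have "\<dots> = mtrace (B * A)"
    using assms(2) by (simp add: mtrace_def mult_mat_index[OF assms(2,1)])
  finally show ?thesis .
qed

lemma kron_zero_left [simp]: "B \<in> carrier_mat b b \<Longrightarrow> kron (0\<^sub>m a a) B = 0\<^sub>m (a * b) (a * b)"
  and kron_zero_right [simp]: "A \<in> carrier_mat a a \<Longrightarrow> kron A (0\<^sub>m b b) = 0\<^sub>m (a * b) (a * b)"
  by (auto simp: kron_def div_mod_less)

lemma kron_add_left:
  assumes "A \<in> carrier_mat a a" "A' \<in> carrier_mat a a" "B \<in> carrier_mat b b"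
  shows "kron (A + A') B = kron A B + kron A' B"
  using assms by (intro eq_matI) (auto simp: kron_def div_mod_less algebra_simps)

lemma kron_add_right:
  assumes "A \<in> carrier_mat a a" "B \<in> carrier_mat b b" "B' \<in> carrier_mat b b"
  shows "kron A (B + B') = kron A B + kron A B'"
  using assms by (intro eq_matI) (auto simp: kron_def div_mod_less algebra_simps)

section \<open>Kraus maps\<close>

lemma sandwich_carrier [simp]:
  fixes K :: "complex mat"
  assumes "K \<in> carrier_mat d' d" "X \<in> carrier_mat d d"
  shows "K * X * mat_adjoint K \<in> carrier_mat d' d'"
  using assms by (meson mat_adjoint_carrier mult_carrier_mat)

lemma sandwich_index:
  assumes "K \<in> carrier_mat d' d" "X \<in> carrier_mat d d" "i < d'" "j < d'"
  shows "(K * X * mat_adjoint K) $$ (i, j) =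
    (\<Sum>r<d. \<Sum>c<d. K $$ (i, r) * X $$ (r, c) * cnj (K $$ (j, c)))"
proof -
  have "(K * X * mat_adjoint K) $$ (i, j) = (\<Sum>c<d. (K * X) $$ (i, c) * mat_adjoint K $$ (c, j))"
    using assms by (intro mult_mat_index) auto
  also have "\<dots> = (\<Sum>c<d. \<Sum>r<d. K $$ (i, r) * X $$ (r, c) * cnj (K $$ (j, c)))"
    using assms by (intro sum.cong) (auto simp: mult_mat_index[OF assms(1,2)]
      mat_adjoint_index[OF assms(1)] sum_distrib_right simp del: index_mult_mat)
  also have "\<dots> = (\<Sum>r<d. \<Sum>c<d. K $$ (i, r) * X $$ (r, c) * cnj (K $$ (j, c)))"
    by (rule sum.swap)
  finally show ?thesis .
qed

lemma sandwich_add: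
  fixes K :: "complex mat"
  assumes "K \<in> carrier_mat d' d" "X \<in> carrier_mat d d" "Y \<in> carrier_mat d d"
  shows "K * (X + Y) * mat_adjoint K = K * X * mat_adjoint K + K * Y * mat_adjoint K"
  unfolding mult_add_distrib_mat[OF assms]
  by (rule add_mult_distrib_mat[OF mult_carrier_mat[OF assms(1,2)] mult_carrier_mat[OF assms(1,3)]
      mat_adjoint_carrier[OF assms(1)]])

lemma sandwich_smult:
  fixes K :: "complex mat"
  assumes "K \<in> carrier_mat d' d" "X \<in> carrier_mat d d"
  shows "K * (c \<cdot>\<^sub>m X) * mat_adjoint K = c \<cdot>\<^sub>m (K * X * mat_adjoint K)"
  unfolding mult_smult_distrib[OF assms]
  by (rule mult_smult_assoc_mat[OF mult_carrier_mat[OF assms] mat_adjoint_carrier[OF assms(1)]])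

lemma sandwich_comp:
  fixes K :: "complex mat"
  assumes "L \<in> carrier_mat d'' d'" "K \<in> carrier_mat d' d" "X \<in> carrier_mat d d"
  shows "L * (K * X * mat_adjoint K) * mat_adjoint L = (L * K) * X * mat_adjoint (L * K)"
proof -
  note [simp] = mat_adjoint_carrier[OF assms(1)] mat_adjoint_carrier[OF assms(2)]
  have KX: "K * X \<in> carrier_mat d' d" using assms by simp
  have "L * (K * X * mat_adjoint K) * mat_adjoint L = L * (K * X) * mat_adjoint K * mat_adjoint L"
    using assms KX by (simp add: assoc_mult_mat[of L d'' d' "K * X" d _ d'])
  also have "\<dots> = L * K * X * mat_adjoint K * mat_adjoint L"
    using assms by (simp add: assoc_mult_mat[of L d'' d' K d _ d])
  also have "\<dots> = L * K * X * (mat_adjoint K * mat_adjoint L)"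
    using assms by (intro assoc_mult_mat[of _ d'' d _ d' _ d'']) auto
  finally show ?thesis
    by (simp add: mat_adjoint_mult[OF assms(1,2)])
qed

lemma kraus_map_Nil [simp]: "kraus_map d [] X = 0\<^sub>m d d"
  and kraus_map_Cons [simp]:
    "kraus_map d (K # Ks) X = K * X * mat_adjoint K + kraus_map d Ks X"
  by (simp_all add: kraus_map_def)

lemma sandwich_set:
  fixes Ks :: "complex mat list"
  assumes "set Ks \<subseteq> carrier_mat d' d" "X \<in> carrier_mat d d"
  shows "set (map (\<lambda>K. K * X * mat_adjoint K) Ks) \<subseteq> carrier_mat d' d'"
  using assms by (auto intro!: sandwich_carrier simp del: sandwich_carrier)

lemma kraus_map_carrier [simp]:
  "set Ks \<subseteq> carrier_mat d' d \<Longrightarrow> X \<in> carrier_mat d d \<Longrightarrow> kraus_map d' Ks X \<in> carrier_mat d' d'"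
  unfolding kraus_map_def by (intro mat_sum_carrier sandwich_set)

lemma kraus_map_index:
  assumes "set Ks \<subseteq> carrier_mat d' d" "X \<in> carrier_mat d d" "i < d'" "j < d'"
  shows "kraus_map d' Ks X $$ (i, j) = (\<Sum>K\<leftarrow>Ks. (K * X * mat_adjoint K) $$ (i, j))"
  using mat_sum_index[OF sandwich_set[OF assms(1,2)] assms(3,4)]
  by (simp add: kraus_map_def o_def)

lemma kraus_map_append:
  assumes "set Ks \<subseteq> carrier_mat d' d" "set Ls \<subseteq> carrier_mat d' d" "X \<in> carrier_mat d d"
  shows "kraus_map d' (Ks @ Ls) X = kraus_map d' Ks X + kraus_map d' Ls X"
  unfolding kraus_map_def map_append
  by (intro mat_sum_append sandwich_set[OF _ assms(3)] assms(1,2))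

lemma add_mat_swap:
  assumes "A \<in> carrier_mat d d" "B \<in> carrier_mat d d" "C \<in> carrier_mat d d" "D \<in> carrier_mat d d"
  shows "(A + B) + (C + D) = (A + C) + (B + (D :: 'a::comm_monoid_add mat))"
  using assms by (intro eq_matI) (auto simp: ac_simps)

lemma kraus_map_add:
  assumes "set Ks \<subseteq> carrier_mat d' d" "X \<in> carrier_mat d d" "Y \<in> carrier_mat d d"
  shows "kraus_map d' Ks (X + Y) = kraus_map d' Ks X + kraus_map d' Ks Y"
  using assms(1)
proof (induction Ks)
  case (Cons K Ks)
  then have K: "K \<in> carrier_mat d' d" and Ks: "set Ks \<subseteq> carrier_mat d' d" by auto
  show ?case
    unfolding kraus_map_Cons sandwich_add[OF K assms(2,3)] Cons.IH[OF Ks]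
    by (intro add_mat_swap[of _ d'] sandwich_carrier[of _ _ d]
        kraus_map_carrier[of _ _ d] K Ks assms)
qed simp

lemma kraus_map_smult:
  assumes "set Ks \<subseteq> carrier_mat d' d" "X \<in> carrier_mat d d"
  shows "kraus_map d' Ks (c \<cdot>\<^sub>m X) = c \<cdot>\<^sub>m kraus_map d' Ks X"
  using assms(1)
proof (induction Ks)
  case (Cons K Ks)
  then have K: "K \<in> carrier_mat d' d" and Ks: "set Ks \<subseteq> carrier_mat d' d" by auto
  show ?case
    unfolding kraus_map_Cons sandwich_smult[OF K assms(2)] Cons.IH[OF Ks]
    by (intro add_smult_distrib_left_mat[symmetric, of _ d' d'] sandwich_carrier[of _ _ d]
        kraus_map_carrier[of _ _ d] K Ks assms)
qed simp

lemma linear_super_kraus_map: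
  "set Ks \<subseteq> carrier_mat d' d \<Longrightarrow> linear_super d d' (kraus_map d' Ks)"
  unfolding linear_super_def by (auto simp: kraus_map_add kraus_map_smult)

lemma kraus_map_comp:
  assumes "set Ls \<subseteq> carrier_mat d'' d'" "set Ks \<subseteq> carrier_mat d' d" "X \<in> carrier_mat d d"
  shows "kraus_map d'' Ls (kraus_map d' Ks X) =
    kraus_map d'' (concat (map (\<lambda>L. map ((*) L) Ks) Ls)) X"
  using assms(1)
proof (induction Ls)
  case (Cons L Ls)
  then have L: "L \<in> carrier_mat d'' d'" by simp
  have "L * kraus_map d' Ks X * mat_adjoint L = kraus_map d'' (map ((*) L) Ks) X"
  proof -
    have "L * mat_sum d' Ms * mat_adjoint L = mat_sum d'' (map (\<lambda>M. L * M * mat_adjoint L) Ms)"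
      if "set Ms \<subseteq> carrier_mat d' d'" for Ms
      by (rule mat_sum_hom[OF _ _ that])
        (use L in \<open>auto simp: sandwich_add[of L d'' d'] left_mult_zero_mat[of _ d'' d'']
          right_mult_zero_mat[OF L] left_mult_zero_mat[OF mat_adjoint_carrier[OF L]]\<close>)
    from this[OF sandwich_set[OF assms(2,3)]] show ?thesis
      using assms(2) by (auto simp: kraus_map_def o_def subset_eq sandwich_comp[OF L _ assms(3)]
          intro!: arg_cong[of _ _ "mat_sum d''"])
  qed
  moreover have "set (map ((*) L) Ks) \<subseteq> carrier_mat d'' d"
    using L assms(2) by auto
  moreover have "set (concat (map (\<lambda>L. map ((*) L) Ks) Ls)) \<subseteq> carrier_mat d'' d"
    using Cons.prems assms(2) by fastforce
  ultimately show ?case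
    using Cons assms(3) by (simp add: kraus_map_append[of _ d'' d])
qed simp

text \<open>Cyclicity of the trace brings out \<open>mat_adjoint K * K\<close>, the expression in
  which the completeness of an instrument is formulated.\<close>

lemma mtrace_kraus_map:
  assumes "set Ks \<subseteq> carrier_mat d' d" "X \<in> carrier_mat d d"
  shows "mtrace (kraus_map d' Ks X) = (\<Sum>K\<leftarrow>Ks. mtrace (mat_adjoint K * K * X))"
proof -
  have "mtrace (K * X * mat_adjoint K) = mtrace (mat_adjoint K * K * X)" if "K \<in> set Ks" for K
  proof -
    have K: "K \<in> carrier_mat d' d" using that assms by auto
    have "mtrace (K * X * mat_adjoint K) = mtrace (mat_adjoint K * (K * X))"
      using K assms(2) by (intro mtrace_comm[of _ d' d]) auto
    also have "mat_adjoint K * (K * X) = mat_adjoint K * K * X"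
      by (rule assoc_mult_mat[OF mat_adjoint_carrier[OF K] K assms(2), symmetric])
    finally show ?thesis .
  qed
  then show ?thesis
    using mtrace_mat_sum[OF sandwich_set[OF assms]]
    by (simp add: kraus_map_def o_def cong: map_cong)
qed

section \<open>Positivity\<close>

lemma adjoint_inner:
  fixes A :: "complex mat"
  assumes "A \<in> carrier_mat m n" "u \<in> carrier_vec n" "v \<in> carrier_vec m"
  shows "(A *\<^sub>v u) \<bullet>c v = u \<bullet>c (mat_adjoint A *\<^sub>v v)"
proof -
  have *: "dim_vec (mat_adjoint A *\<^sub>v v) = n" using mat_adjoint_carrier[OF assms(1)] by auto
  have "(A *\<^sub>v u) \<bullet>c v = (\<Sum>i<m. \<Sum>k<n. A $$ (i, k) * u $ k * cnj (v $ i))"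
    using assms by (auto simp: scalar_prod_def atLeast0LessThan sum_distrib_right intro!: sum.cong)
  also have "\<dots> = (\<Sum>k<n. \<Sum>i<m. A $$ (i, k) * u $ k * cnj (v $ i))"
    by (rule sum.swap)
  also have "\<dots> = (\<Sum>k<n. u $ k * cnj ((mat_adjoint A *\<^sub>v v) $ k))"
    using assms by (intro sum.cong) (auto simp: mult_mat_vec_index[OF mat_adjoint_carrier[OF assms(1)] assms(3)]
      mat_adjoint_index[OF assms(1)] sum_distrib_left mult_ac intro!: sum.cong)
  also have "\<dots> = u \<bullet>c (mat_adjoint A *\<^sub>v v)"
    using assms * by (simp add: scalar_prod_def atLeast0LessThan)
  finally show ?thesis .
qed

lemma psd_zero: "psd d (0\<^sub>m d d)"
  by (auto simp: psd_def scalar_prod_def)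

lemma psd_add:
  assumes "psd d A" "psd d B"
  shows "psd d (A + B)"
proof -
  have "0 \<le> ((A + B) *\<^sub>v v) \<bullet>c v" if "v \<in> carrier_vec d" for v
  proof -
    have "((A + B) *\<^sub>v v) \<bullet>c v = (A *\<^sub>v v) \<bullet>c v + (B *\<^sub>v v) \<bullet>c v"
      using assms that unfolding psd_def
      by (auto simp: add_mult_distrib_mat_vec[of A d d B v] add_scalar_prod_distrib[of _ d])
    then show ?thesis using assms that by (simp add: psd_def)
  qed
  with assms show ?thesis by (auto simp: psd_def)
qed

lemma psd_sandwich:
  assumes "K \<in> carrier_mat d' d" "psd d X"
  shows "psd d' (K * X * mat_adjoint K)"
proof -
  have X: "X \<in> carrier_mat d d" using assms by (simp add: psd_def)
  have "0 \<le> ((K * X * mat_adjoint K) *\<^sub>v v) \<bullet>c v" if v: "v \<in> carrier_vec d'" for v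
  proof -
    have w: "mat_adjoint K *\<^sub>v v \<in> carrier_vec d"
      using mat_adjoint_carrier[OF assms(1)] v by auto
    have "(K * X * mat_adjoint K) *\<^sub>v v = (K * X) *\<^sub>v (mat_adjoint K *\<^sub>v v)"
      using assms(1) X v by (intro assoc_mult_mat_vec[of _ d' d]) auto
    also have "\<dots> = K *\<^sub>v (X *\<^sub>v (mat_adjoint K *\<^sub>v v))"
      using assms(1) X w by (intro assoc_mult_mat_vec[of _ d' d]) auto
    finally have "((K * X * mat_adjoint K) *\<^sub>v v) \<bullet>c v
        = (X *\<^sub>v (mat_adjoint K *\<^sub>v v)) \<bullet>c (mat_adjoint K *\<^sub>v v)"
      using X w v by (simp add: adjoint_inner[OF assms(1)])
    then show ?thesis using assms(2) w by (simp add: psd_def)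
  qed
  with sandwich_carrier[OF assms(1) X] show ?thesis by (simp add: psd_def)
qed

lemma psd_kraus_map:
  assumes "set Ks \<subseteq> carrier_mat d' d" "psd d X"
  shows "psd d' (kraus_map d' Ks X)"
  using assms(1) by (induction Ks) (auto intro!: psd_zero psd_add psd_sandwich assms(2))

lemma psd_mtrace_nonneg:
  assumes "psd d A"
  shows "0 \<le> mtrace A"
proof -
  have A: "A \<in> carrier_mat d d" using assms by (simp add: psd_def)
  have "0 \<le> A $$ (i, i)" if "i < d" for i
  proof -
    have "(A *\<^sub>v unit_vec d i) \<bullet>c unit_vec d i = A $$ (i, i)"
      using A that by (simp add: scalar_prod_def unit_vec_def if_distrib cong: if_cong)
    then show ?thesis using assms by (metis psd_def unit_vec_carrier)
  qed
  then show ?thesis using A by (auto simp: mtrace_def intro!: sum_nonneg)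
qed

text \<open>The maps of \<open>locc_pair\<close> are prescribed only on matrices of the right size;
  the blocks formed by \<open>ampliation\<close> have that size.\<close>

lemma ampliation_cong:
  assumes "\<And>X. X \<in> carrier_mat d d \<Longrightarrow> E X = F X"
  shows "ampliation k d d' E X = ampliation k d d' F X"
  unfolding ampliation_def by (intro cong_mat) (auto simp: assms)

text \<open>Tensoring with a reference replaces each \<open>K\<close> by
  \<open>kron (1\<^sub>m k) K\<close>, so the ampliation is again a Kraus map. Complete positivity
  thereby reduces to plain positivity of Kraus maps.\<close>

lemma ampliation_kraus_map:
  assumes "set Ks \<subseteq> carrier_mat d' d" "X \<in> carrier_mat (k * d) (k * d)"
  shows "ampliation k d d' (kraus_map d' Ks) X = kraus_map (k * d') (map (kron (1\<^sub>m k)) Ks) X"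
proof (rule eq_matI)
  have Ks': "set (map (kron (1\<^sub>m k)) Ks) \<subseteq> carrier_mat (k * d') (k * d)"
    using assms(1) by (auto intro!: kron_carrier)
  have car: "kraus_map (k * d') (map (kron (1\<^sub>m k)) Ks) X \<in> carrier_mat (k * d') (k * d')"
    using Ks' assms(2) by (rule kraus_map_carrier)
  then show "dim_row (ampliation k d d' (kraus_map d' Ks) X) = dim_row (kraus_map (k * d') (map (kron (1\<^sub>m k)) Ks) X)"
    "dim_col (ampliation k d d' (kraus_map d' Ks) X) = dim_col (kraus_map (k * d') (map (kron (1\<^sub>m k)) Ks) X)"
    by (auto simp: ampliation_def)
  fix i j assume "i < dim_row (kraus_map (k * d') (map (kron (1\<^sub>m k)) Ks) X)"
    "j < dim_col (kraus_map (k * d') (map (kron (1\<^sub>m k)) Ks) X)"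
  with car have ij: "i < k * d'" "j < k * d'" by auto
  note ij' = div_mod_less[OF ij(1)] div_mod_less[OF ij(2)]
  \<comment> \<open>The block of \<open>X\<close> that alone contributes to entry
    \<open>(i, j)\<close>, because \<open>kron (1\<^sub>m k) K\<close> is block diagonal.\<close>
  define Y where "Y = mat d d (\<lambda>(r, c). X $$ ((i div d') * d + r, (j div d') * d + c))"
  have Y: "Y \<in> carrier_mat d d" by (simp add: Y_def)
  have "(K * Y * mat_adjoint K) $$ (i mod d', j mod d') =
      (kron (1\<^sub>m k) K * X * mat_adjoint (kron (1\<^sub>m k) K)) $$ (i, j)" if "K \<in> set Ks" for K
  proof -
    have K: "K \<in> carrier_mat d' d" using that assms(1) by auto
    define g where "g y y' = K $$ (i mod d', y) * X $$ (i div d' * d + y, j div d' * d + y') *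
            cnj (K $$ (j mod d', y'))" for y y'
    have ki: "kron (1\<^sub>m k) K $$ (i, r) = (if i div d' = r div d then K $$ (i mod d', r mod d) else 0)"
      if "r < k * d" for r
      using that ij' div_mod_less[OF that] K ij by (simp add: kron_index[of _ k k _ d' d])
    have kj: "kron (1\<^sub>m k) K $$ (j, r) = (if j div d' = r div d then K $$ (j mod d', r mod d) else 0)"
      if "r < k * d" for r
      using that ij' div_mod_less[OF that] K ij by (simp add: kron_index[of _ k k _ d' d])
    define h where "h x y x' y' = (if i div d' = x \<and> j div d' = x' then g y y' else 0)" for x y x' y'
    have "(kron (1\<^sub>m k) K * X * mat_adjoint (kron (1\<^sub>m k) K)) $$ (i, j) =
       (\<Sum>r<k * d. \<Sum>c<k * d. kron (1\<^sub>m k) K $$ (i, r) * X $$ (r, c) * cnj (kron (1\<^sub>m k) K $$ (j, c)))"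
      using ij assms(2) K by (intro sandwich_index) auto
    also have "\<dots> = (\<Sum>r<k * d. \<Sum>c<k * d. h (r div d) (r mod d) (c div d) (c mod d))"
      by (intro sum.cong refl) (auto simp: ki kj g_def h_def)
    also have "\<dots> = (\<Sum>r<k * d. \<Sum>x'<k. \<Sum>y'<d. h (r div d) (r mod d) x' y')"
      by (simp only: sum_div_mod[of "h x y" for x y])
    also have "\<dots> = (\<Sum>x<k. \<Sum>y<d. \<Sum>x'<k. \<Sum>y'<d. h x y x' y')"
      by (rule sum_div_mod[of "\<lambda>x y. \<Sum>x'<k. \<Sum>y'<d. h x y x' y'"])
    \<comment> \<open>Nesting the two block conditions lets the sums over \<open>x'\<close> and
      \<open>x\<close> collapse one after the other; both selected block indices are below
      \<open>k\<close>.\<close>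
    also have "\<dots> = (\<Sum>x<k. \<Sum>y<d. if i div d' = x then \<Sum>y'<d. g y y' else 0)"
    proof -
      have "(\<Sum>y'<d. h x y x' y') =
          (if j div d' = x' then if i div d' = x then \<Sum>y'<d. g y y' else 0 else 0)" for x y x'
        by (simp add: h_def)
      then show ?thesis using ij' by simp
    qed
    also have "\<dots> = (\<Sum>y<d. \<Sum>x<k. if i div d' = x then \<Sum>y'<d. g y y' else 0)"
      by (rule sum.swap)
    also have "\<dots> = (\<Sum>y<d. \<Sum>y'<d. g y y')"
      using ij' by simp
    also have "\<dots> = (K * Y * mat_adjoint K) $$ (i mod d', j mod d')"
      unfolding sandwich_index[OF K Y ij'(2) ij'(4)] by (intro sum.cong refl) (simp add: g_def Y_def)
    finally show ?thesis by simp
  qed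
  then show "ampliation k d d' (kraus_map d' Ks) X $$ (i, j) =
      kraus_map (k * d') (map (kron (1\<^sub>m k)) Ks) X $$ (i, j)"
    using ij ij'
    by (simp add: kraus_map_index[OF Ks' assms(2)] kraus_map_index[OF assms(1) Y] o_def
        ampliation_def Y_def[symmetric] cong: map_cong)
qed

lemma completely_positive_kraus_map:
  assumes "set Ks \<subseteq> carrier_mat d' d" "\<And>X. X \<in> carrier_mat d d \<Longrightarrow> E X = kraus_map d' Ks X"
  shows "completely_positive d d' E"
  unfolding completely_positive_def
proof (intro conjI allI impI)
  show "linear_super d d' E"
    using linear_super_kraus_map[OF assms(1)] assms(2) by (simp add: linear_super_def)
  fix k X assume X: "psd (k * d) X"
  then have "ampliation k d d' E X = kraus_map (k * d') (map (kron (1\<^sub>m k)) Ks) X"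
    using ampliation_cong[OF assms(2)] ampliation_kraus_map[OF assms(1)] by (simp add: psd_def)
  then show "psd (k * d') (ampliation k d d' E X)"
    using X assms(1) by (auto intro!: psd_kraus_map[of _ _ "k * d"] kron_carrier)
qed

section \<open>LOCC maps are separable\<close>

text \<open>The standard outer relaxation of LOCC. It carries no completeness relation because it
  describes single branches of a protocol, and it is stable under composition and sums.\<close>

definition separable ::
    "nat \<Rightarrow> nat \<Rightarrow> nat \<Rightarrow> nat \<Rightarrow> (complex mat \<Rightarrow> complex mat) \<Rightarrow> bool" where
  "separable a' b' a b F \<longleftrightarrow> (\<exists>Ps. set Ps \<subseteq> carrier_mat a' a \<times> carrier_mat b' b \<and>
     (\<forall>X \<in> carrier_mat (a * b) (a * b). F X = kraus_map (a' * b') (map (\<lambda>(A, B). kron A B) Ps) X))"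

lemma separableI:
  assumes "set Ps \<subseteq> carrier_mat a' a \<times> carrier_mat b' b"
    and "\<And>X. X \<in> carrier_mat (a * b) (a * b) \<Longrightarrow>
      F X = kraus_map (a' * b') (map (\<lambda>(A, B). kron A B) Ps) X"
  shows "separable a' b' a b F"
  using assms unfolding separable_def by blast

lemma product_kraus_set:
  "set Ps \<subseteq> carrier_mat a' a \<times> carrier_mat b' b \<Longrightarrow>
    set (map (\<lambda>(A, B). kron A B) Ps) \<subseteq> carrier_mat (a' * b') (a * b)"
  by (auto intro!: kron_carrier)

lemma separable_id: "separable a b a b (\<lambda>X. X)"
proof (rule separableI[of "[(1\<^sub>m a, 1\<^sub>m b)]"])
  fix X :: "complex mat" assume X: "X \<in> carrier_mat (a * b) (a * b)"
  then show "X = kraus_map (a * b) (map (\<lambda>(A, B). kron A B) [(1\<^sub>m a, 1\<^sub>m b)]) X"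
    by simp
qed simp

text \<open>Products of the form \<open>kron A B * kron C D\<close> are again Kronecker products, so
  all pairwise products of the two Kraus lists serve.\<close>

lemma separable_comp:
  assumes "separable a'' b'' a' b' F" "separable a' b' a b G"
  shows "separable a'' b'' a b (\<lambda>X. F (G X))"
proof -
  obtain Ls where Ls: "set Ls \<subseteq> carrier_mat a'' a' \<times> carrier_mat b'' b'"
    "\<And>X. X \<in> carrier_mat (a' * b') (a' * b') \<Longrightarrow>
      F X = kraus_map (a'' * b'') (map (\<lambda>(A, B). kron A B) Ls) X"
    using assms(1) unfolding separable_def by blast
  obtain Ps where Ps: "set Ps \<subseteq> carrier_mat a' a \<times> carrier_mat b' b"
    "\<And>X. X \<in> carrier_mat (a * b) (a * b) \<Longrightarrow>
      G X = kraus_map (a' * b') (map (\<lambda>(A, B). kron A B) Ps) X"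
    using assms(2) unfolding separable_def by blast
  define Rs where "Rs = concat (map (\<lambda>(A, B). map (\<lambda>(C, D). (A * C, B * D)) Ps) Ls)"
  have "set Rs \<subseteq> carrier_mat a'' a \<times> carrier_mat b'' b"
    using Ls(1) Ps(1) unfolding Rs_def by fastforce
  moreover have "F (G X) = kraus_map (a'' * b'') (map (\<lambda>(A, B). kron A B) Rs) X"
    if X: "X \<in> carrier_mat (a * b) (a * b)" for X
  proof -
    have "map (\<lambda>(A, B). kron A B) Rs = concat (map (\<lambda>L. map ((*) L) (map (\<lambda>(A, B). kron A B) Ps))
        (map (\<lambda>(A, B). kron A B) Ls))"
    proof -
      have "kron (A * C) (B * D) = kron A B * kron C D" if "(A, B) \<in> set Ls" "(C, D) \<in> set Ps"
        for A B C D
        using that Ls(1) Ps(1) by (intro kron_mult[symmetric, of _ a'' a' _ b'' b' _ a _ b]) auto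
      then show ?thesis
        unfolding Rs_def map_concat map_map
        by (intro arg_cong[of _ _ concat] map_cong[OF refl]) (auto simp: o_def)
    qed
    then show ?thesis
      using Ls Ps X product_kraus_set[OF Ls(1)] product_kraus_set[OF Ps(1)]
      by (simp add: kraus_map_comp[OF product_kraus_set[OF Ls(1)] product_kraus_set[OF Ps(1)]])
  qed
  ultimately show ?thesis by (rule separableI)
qed

lemma separable_mat_sum:
  assumes "\<And>F. F \<in> set Fs \<Longrightarrow> separable a' b' a b F"
  shows "separable a' b' a b (\<lambda>X. mat_sum (a' * b') (map (\<lambda>F. F X) Fs))"
  using assms
proof (induction Fs)
  case Nil
  show ?case by (rule separableI[of "[]"]) auto
next
  case (Cons F Fs)
  obtain Ls where Ls: "set Ls \<subseteq> carrier_mat a' a \<times> carrier_mat b' b"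
    "\<And>X. X \<in> carrier_mat (a * b) (a * b) \<Longrightarrow>
      F X = kraus_map (a' * b') (map (\<lambda>(A, B). kron A B) Ls) X"
    using Cons.prems[of F] unfolding separable_def by auto
  obtain Ps where Ps: "set Ps \<subseteq> carrier_mat a' a \<times> carrier_mat b' b"
    "\<And>X. X \<in> carrier_mat (a * b) (a * b) \<Longrightarrow>
      mat_sum (a' * b') (map (\<lambda>F. F X) Fs) = kraus_map (a' * b') (map (\<lambda>(A, B). kron A B) Ps) X"
    using Cons unfolding separable_def by auto
  show ?case
    by (rule separableI[of "Ls @ Ps"])
      (use Ls(1) Ps(1) in \<open>auto simp: Ls(2) Ps(2)
        kraus_map_append[OF product_kraus_set[OF Ls(1)] product_kraus_set[OF Ps(1)]]\<close>)
qed

lemma separable_completely_positive: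
  "separable a' b' a b F \<Longrightarrow> completely_positive (a * b) (a' * b') F"
  unfolding separable_def by (metis completely_positive_kraus_map product_kraus_set)

lemma separable_psd: "separable a' b' a b F \<Longrightarrow> psd (a * b) X \<Longrightarrow> psd (a' * b') (F X)"
  unfolding separable_def by (metis psd_kraus_map product_kraus_set psd_def)

lemma separable_carrier:
  "separable a' b' a b F \<Longrightarrow> X \<in> carrier_mat (a * b) (a * b) \<Longrightarrow> F X \<in> carrier_mat (a' * b') (a' * b')"
  unfolding separable_def by (metis kraus_map_carrier product_kraus_set)

lemma separable_alice:
  assumes "set Ks \<subseteq> carrier_mat d a"
  shows "separable d b a b (kraus_map (d * b) (map (\<lambda>K. kron K (1\<^sub>m b)) Ks))"
  by (rule separableI[of "map (\<lambda>K. (K, 1\<^sub>m b)) Ks"]) (use assms in \<open>auto simp: o_def\<close>)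

lemma separable_bob:
  assumes "set Ks \<subseteq> carrier_mat d b"
  shows "separable a d a b (kraus_map (a * d) (map (\<lambda>K. kron (1\<^sub>m a) K) Ks))"
  by (rule separableI[of "map (\<lambda>K. (1\<^sub>m a, K)) Ks"]) (use assms in \<open>auto simp: o_def\<close>)

section \<open>Conservation of the total trace over rounds and transcripts\<close>

text \<open>Abstracting the embedding of a local Kraus operator (\<open>h\<close>), that of its
  effect (\<open>g\<close>) and the output dimension (\<open>m\<close>) lets one argument serve both
  parties: \<open>h K\<close> is \<open>kron K (1\<^sub>m b)\<close> for Alice and
  \<open>kron (1\<^sub>m a) K\<close> for Bob.\<close>

lemma local_instrument_trace:
  assumes li: "local_instrument a ops" and X: "X \<in> carrier_mat n n"
    and h: "\<And>K d. K \<in> carrier_mat d a \<Longrightarrow> h K \<in> carrier_mat (m d) n \<and>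
      mat_adjoint (h K) * h K = g (mat_adjoint K * K)"
    and g0: "g (0\<^sub>m a a) = 0\<^sub>m n n" and g1: "g (1\<^sub>m a) = 1\<^sub>m n"
    and gadd: "\<And>A B. A \<in> carrier_mat a a \<Longrightarrow> B \<in> carrier_mat a a \<Longrightarrow>
      g A \<in> carrier_mat n n \<and> g (A + B) = g A + g B"
  shows "(\<Sum>(d, Ks)\<leftarrow>ops. mtrace (kraus_map (m d) (map h Ks) X)) = mtrace X"
proof -
  let ?KK = "map (\<lambda>K. mat_adjoint K * K) (concat (map snd ops))"
  have K: "set Ks \<subseteq> carrier_mat d a" if "(d, Ks) \<in> set ops" for d Ks
    using that li by (auto simp: local_instrument_def)
  have KK: "set ?KK \<subseteq> carrier_mat a a"
  proof -
    have "mat_adjoint L * L \<in> carrier_mat a a" if "(d, Ks) \<in> set ops" "L \<in> set Ks" for d Ks L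
      using that K by (meson mat_adjoint_carrier mult_carrier_mat subset_iff)
    then show ?thesis by fastforce
  qed
  have f_add: "mtrace (g (A + B) * X) = mtrace (g A * X) + mtrace (g B * X)"
    if "A \<in> carrier_mat a a" "B \<in> carrier_mat a a" for A B
  proof -
    have "g A \<in> carrier_mat n n" "g B \<in> carrier_mat n n" "g (A + B) = g A + g B"
      using gadd that by blast+
    then show ?thesis
      using X by (simp add: add_mult_distrib_mat[of _ n n] mtrace_add[of _ n])
  qed
  have "(\<Sum>(d, Ks)\<leftarrow>ops. mtrace (kraus_map (m d) (map h Ks) X))
      = (\<Sum>(d, Ks)\<leftarrow>ops. \<Sum>K\<leftarrow>Ks. mtrace (g (mat_adjoint K * K) * X))"
  proof (intro arg_cong[of _ _ sum_list] map_cong refl, clarify)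
    fix d Ks assume *: "(d, Ks) \<in> set ops"
    have "set (map h Ks) \<subseteq> carrier_mat (m d) n" using K[OF *] h by auto
    from mtrace_kraus_map[OF this X]
    have "mtrace (kraus_map (m d) (map h Ks) X) = (\<Sum>K\<leftarrow>Ks. mtrace (mat_adjoint (h K) * h K * X))"
      by (simp add: o_def)
    also have "\<dots> = (\<Sum>K\<leftarrow>Ks. mtrace (g (mat_adjoint K * K) * X))"
    proof (intro arg_cong[of _ _ sum_list] map_cong refl)
      fix L assume "L \<in> set Ks"
      then have "L \<in> carrier_mat d a" using K[OF *] by auto
      then show "mtrace (mat_adjoint (h L) * h L * X) = mtrace (g (mat_adjoint L * L) * X)"
        using h by simp
    qed
    finally show "mtrace (kraus_map (m d) (map h Ks) X) =
      (\<Sum>K\<leftarrow>Ks. mtrace (g (mat_adjoint K * K) * X))" .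
  qed
  also have "\<dots> = (\<Sum>A\<leftarrow>?KK. mtrace (g A * X))"
    by (induction ops) (auto simp: o_def)
  \<comment> \<open>The trace against \<open>X\<close> is additive in the effect, so the sum over
    all Kraus operators of all outcomes becomes its value at the completeness sum.\<close>
  also have "\<dots> = mtrace (g (mat_sum a ?KK) * X)"
    using f_add g0 X by (intro mat_sum_additive[symmetric] KK) (auto simp: left_mult_zero_mat[of _ n n])
  also have "mat_sum a ?KK = 1\<^sub>m a"
    using li by (simp add: local_instrument_def)
  finally show ?thesis using g1 X by simp
qed

lemma alice_trace:
  assumes "local_instrument a ops" "X \<in> carrier_mat (a * b) (a * b)"
  shows "(\<Sum>(d, Ks)\<leftarrow>ops. mtrace (kraus_map (d * b) (map (\<lambda>K. kron K (1\<^sub>m b)) Ks) X)) = mtrace X"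
proof (rule local_instrument_trace[OF assms, where g = "\<lambda>A. kron A (1\<^sub>m b)"])
  fix K :: "complex mat" and d assume K: "K \<in> carrier_mat d a"
  show "kron K (1\<^sub>m b) \<in> carrier_mat (d * b) (a * b) \<and>
      mat_adjoint (kron K (1\<^sub>m b)) * kron K (1\<^sub>m b) = kron (mat_adjoint K * K) (1\<^sub>m b)"
    using K kron_mult[OF mat_adjoint_carrier[OF K] one_carrier_mat K one_carrier_mat]
    by (simp add: mat_adjoint_kron[OF K one_carrier_mat])
qed (auto simp: kron_add_left[of _ a _ _ b])

lemma bob_trace:
  assumes "local_instrument b ops" "X \<in> carrier_mat (a * b) (a * b)"
  shows "(\<Sum>(d, Ks)\<leftarrow>ops. mtrace (kraus_map (a * d) (map (\<lambda>K. kron (1\<^sub>m a) K) Ks) X)) = mtrace X"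
proof (rule local_instrument_trace[OF assms, where g = "\<lambda>A. kron (1\<^sub>m a) A"])
  fix K :: "complex mat" and d assume K: "K \<in> carrier_mat d b"
  show "kron (1\<^sub>m a) K \<in> carrier_mat (a * d) (a * b) \<and>
      mat_adjoint (kron (1\<^sub>m a) K) * kron (1\<^sub>m a) K = kron (1\<^sub>m a) (mat_adjoint K * K)"
    using K kron_mult[OF one_carrier_mat mat_adjoint_carrier[OF K] one_carrier_mat K]
    by (simp add: mat_adjoint_kron[OF one_carrier_mat K])
qed (auto simp: kron_add_right[of _ a _ b])

text \<open>Grouping the transcripts by the first outcome, the continuation after that outcome
  conserves trace on the set \<open>C\<close> in which the post-measurement operator lies, so each
  group contributes just the trace after the first round.\<close>

lemma transcripts_trace:
  assumes "list_all2 (\<lambda>p Fs. G (fst p) (snd p) X \<in> C (fst p) \<and>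
      (\<forall>Y \<in> C (fst p). (\<Sum>F\<leftarrow>Fs. mtrace (F Y)) = mtrace Y)) ops Fss"
  shows "(\<Sum>F\<leftarrow>concat (map (\<lambda>((d, Ks), Fs). map (\<lambda>F X. F (G d Ks X)) Fs) (zip ops Fss)). mtrace (F X))
    = (\<Sum>(d, Ks)\<leftarrow>ops. mtrace (G d Ks X))"
  using assms by (induction rule: list_all2_induct) (auto simp: o_def)

definition trace_complete :: "nat \<Rightarrow> (complex mat \<Rightarrow> complex mat) list \<Rightarrow> bool" where
  "trace_complete d Fs \<longleftrightarrow> (\<forall>X \<in> carrier_mat d d. (\<Sum>F\<leftarrow>Fs. mtrace (F X)) = mtrace X)"

text \<open>The dimensions \<open>a'\<close> and \<open>b'\<close> are functions of the outcome: the
  acting party's dimension varies with it while the other one stays fixed.\<close>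

lemma round_separable:
  assumes "list_all2 (\<lambda>p Fs. separable (a' p) (b' p) a b (G (fst p) (snd p)) \<and>
      (\<forall>F \<in> set Fs. separable a'' b'' (a' p) (b' p) F)) ops Fss"
    and "F \<in> set (concat (map (\<lambda>((d, Ks), Fs). map (\<lambda>F X. F (G d Ks X)) Fs) (zip ops Fss)))"
  shows "separable a'' b'' a b F"
proof -
  obtain d Ks Fs F' where z: "((d, Ks), Fs) \<in> set (zip ops Fss)" and F': "F' \<in> set Fs"
    and F: "F = (\<lambda>X. F' (G d Ks X))"
    using assms(2) by auto
  have "separable (a' (d, Ks)) (b' (d, Ks)) a b (G d Ks)" "separable a'' b'' (a' (d, Ks)) (b' (d, Ks)) F'"
    using assms(1) z F' by (auto simp: list_all2_iff)
  from separable_comp[OF this(2,1)] show ?thesis unfolding F .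
qed

text \<open>By induction over the rounds. Each round inserts factors
  \<open>kron K (1\<^sub>m b)\<close> or \<open>kron (1\<^sub>m a) K\<close>, so every transcript
  accumulates product operators, and the completeness of each local instrument carries the
  conservation of total trace from the continuations to the whole protocol.\<close>

lemma locc_instrument_separable:
  assumes "locc_instrument a' b' a b Fs"
  shows "(\<forall>F \<in> set Fs. separable a' b' a b F) \<and> trace_complete (a * b) Fs"
  using assms
proof induction
  case finish
  show ?case by (auto simp: separable_id trace_complete_def)
next
  case (alice a ops b Fss)
  let ?G = "\<lambda>d Ks X. kraus_map (d * b) (map (\<lambda>K. kron K (1\<^sub>m b)) Ks) X"
  have sep: "separable (fst p) b a b (?G (fst p) (snd p))" if "p \<in> set ops" for p
    using that alice.hyps(1) by (intro separable_alice) (cases p, auto simp: local_instrument_def)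
  have "separable a' b' a b F" if "F \<in> set (concat (map (\<lambda>((d, Ks), Fs).
      map (\<lambda>F X. F (?G d Ks X)) Fs) (zip ops Fss)))" for F
    by (rule round_separable[where a' = fst and b' = "\<lambda>_. b" and G = ?G, OF _ that])
      (rule list.rel_mono_strong[OF alice.IH], blast intro: sep)
  moreover have "(\<Sum>F\<leftarrow>concat (map (\<lambda>((d, Ks), Fs). map (\<lambda>F X. F (?G d Ks X)) Fs) (zip ops Fss)).
      mtrace (F X)) = mtrace X" if X: "X \<in> carrier_mat (a * b) (a * b)" for X
    unfolding alice_trace[OF alice.hyps(1) X, symmetric]
    by (rule transcripts_trace[where G = ?G and C = "\<lambda>d. carrier_mat (d * b) (d * b)"])
      (rule list.rel_mono_strong[OF alice.IH],
        unfold trace_complete_def, blast intro: separable_carrier[OF sep X])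
  ultimately show ?case unfolding trace_complete_def by blast
next
  case (bob b ops a Fss)
  let ?G = "\<lambda>d Ks X. kraus_map (a * d) (map (\<lambda>K. kron (1\<^sub>m a) K) Ks) X"
  have sep: "separable a (fst p) a b (?G (fst p) (snd p))" if "p \<in> set ops" for p
    using that bob.hyps(1) by (intro separable_bob) (cases p, auto simp: local_instrument_def)
  have "separable a' b' a b F" if "F \<in> set (concat (map (\<lambda>((d, Ks), Fs).
      map (\<lambda>F X. F (?G d Ks X)) Fs) (zip ops Fss)))" for F
    by (rule round_separable[where a' = "\<lambda>_. a" and b' = fst and G = ?G, OF _ that])
      (rule list.rel_mono_strong[OF bob.IH], blast intro: sep)
  moreover have "(\<Sum>F\<leftarrow>concat (map (\<lambda>((d, Ks), Fs). map (\<lambda>F X. F (?G d Ks X)) Fs) (zip ops Fss)).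
      mtrace (F X)) = mtrace X" if X: "X \<in> carrier_mat (a * b) (a * b)" for X
    unfolding bob_trace[OF bob.hyps(1) X, symmetric]
    by (rule transcripts_trace[where G = ?G and C = "\<lambda>d. carrier_mat (a * d) (a * d)"])
      (rule list.rel_mono_strong[OF bob.IH],
        unfold trace_complete_def, blast intro: separable_carrier[OF sep X])
  ultimately show ?case unfolding trace_complete_def by blast
qed

section \<open>Grouping transcripts into a success and a failure branch\<close>

lemma sum_list_nths_Compl:
  fixes xs :: "'a::comm_monoid_add list"
  shows "sum_list (nths xs I) + sum_list (nths xs (- I)) = sum_list xs"
proof (induction xs arbitrary: I)
  case (Cons x xs)
  \<comment> \<open>Removing the head shifts the position set by one, and the shift commutes with
    complementation, so the induction hypothesis applies to both sublists.\<close>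
  have "{j. Suc j \<in> - I} = - {j. Suc j \<in> I}" by auto
  with Cons[of "{j. Suc j \<in> I}"] show ?case
    by (auto simp: nths_Cons ac_simps)
qed simp

lemma separable_cong:
  assumes "separable a' b' a b F" "\<And>X. X \<in> carrier_mat (a * b) (a * b) \<Longrightarrow> E X = F X"
  shows "separable a' b' a b E"
  using assms unfolding separable_def by auto

lemma locc_pair_separable:
  assumes "locc_pair a b a' b' E1 E2"
  shows "separable a' b' a b E1" "separable a' b' a b E2"
    and "trace_preserving (a * b) (\<lambda>X. E1 X + E2 X)"
proof -
  obtain Fs I where Fs: "locc_instrument a' b' a b Fs"
    and E: "\<And>X. X \<in> carrier_mat (a * b) (a * b) \<Longrightarrow> E1 X = mat_sum (a' * b') (map (\<lambda>F. F X) (nths Fs I))"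
      "\<And>X. X \<in> carrier_mat (a * b) (a * b) \<Longrightarrow> E2 X = mat_sum (a' * b') (map (\<lambda>F. F X) (nths Fs (- I)))"
    using assms unfolding locc_pair_def by blast
  note sep = locc_instrument_separable[OF Fs]
  have sub: "F \<in> set Fs" if "F \<in> set (nths Fs J)" for F J
    using that by (rule in_set_nthsD)
  have sum: "separable a' b' a b (\<lambda>X. mat_sum (a' * b') (map (\<lambda>F. F X) (nths Fs J)))" for J
    using sep sub by (intro separable_mat_sum) blast
  show E1: "separable a' b' a b E1"
    by (rule separable_cong[OF sum]) (rule E(1))
  show E2: "separable a' b' a b E2"
    by (rule separable_cong[OF sum]) (rule E(2))
  show "trace_preserving (a * b) (\<lambda>X. E1 X + E2 X)"
    unfolding trace_preserving_def
  proof
    fix X :: "complex mat" assume X: "X \<in> carrier_mat (a * b) (a * b)"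
    have "separable a' b' a b F" if "F \<in> set (nths Fs J)" for F J
      using sep sub[OF that] by blast
    then have "set (map (\<lambda>F. F X) (nths Fs J)) \<subseteq> carrier_mat (a' * b') (a' * b')" for J
      using separable_carrier[OF _ X] by auto
    from mtrace_mat_sum[OF this]
    have *: "mtrace (mat_sum (a' * b') (map (\<lambda>F. F X) (nths Fs J)))
        = sum_list (nths (map (\<lambda>F. mtrace (F X)) Fs) J)" for J
      by (simp add: o_def nths_map)
    have "mtrace (E1 X + E2 X) = mtrace (E1 X) + mtrace (E2 X)"
      by (rule mtrace_add[OF separable_carrier[OF E1 X] separable_carrier[OF E2 X]])
    also have "\<dots> = (\<Sum>F\<leftarrow>Fs. mtrace (F X))"
      by (simp only: E[OF X] * sum_list_nths_Compl)
    also have "\<dots> = mtrace X"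
      using sep X unfolding trace_complete_def by blast
    finally show "mtrace (E1 X + E2 X) = mtrace X" .
  qed
qed

text \<open>Both branches are positive maps, hence have nonnegative traces on positive inputs, and
  the two traces add up to that of the input.\<close>

lemma locc_pair_trace_nonincreasing:
  assumes "locc_pair a b a' b' E1 E2"
  shows "trace_nonincreasing (a * b) E1" "trace_nonincreasing (a * b) E2"
proof -
  note sep = locc_pair_separable[OF assms]
  have *: "mtrace (E1 X) + mtrace (E2 X) = mtrace X" "0 \<le> mtrace (E1 X)" "0 \<le> mtrace (E2 X)"
    if "psd (a * b) X" for X
  proof -
    have X: "X \<in> carrier_mat (a * b) (a * b)" using that by (simp add: psd_def)
    have "mtrace (E1 X + E2 X) = mtrace X"
      using sep(3) X by (simp add: trace_preserving_def)
    then show "mtrace (E1 X) + mtrace (E2 X) = mtrace X"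
      using mtrace_add[OF separable_carrier[OF sep(1) X] separable_carrier[OF sep(2) X]] by simp
    show "0 \<le> mtrace (E1 X)" "0 \<le> mtrace (E2 X)"
      using separable_psd[OF sep(1) that] separable_psd[OF sep(2) that] psd_mtrace_nonneg by blast+
  qed
  show "trace_nonincreasing (a * b) E1" "trace_nonincreasing (a * b) E2"
    unfolding trace_nonincreasing_def by (simp_all add: *(2,3) flip: *(1))
qed

section \<open>Pure states\<close>

lemma proj_carrier [simp]: "v \<in> carrier_vec n \<Longrightarrow> proj v \<in> carrier_mat n n"
  by (auto simp: proj_def)

lemma proj_index:
  "v \<in> carrier_vec n \<Longrightarrow> i < n \<Longrightarrow> j < n \<Longrightarrow> proj v $$ (i, j) = v $ i * cnj (v $ j)"
  by (auto simp: proj_def)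

lemma sandwich_proj:
  assumes "K \<in> carrier_mat m n" "v \<in> carrier_vec n"
  shows "K * proj v * mat_adjoint K = proj (K *\<^sub>v v)"
proof (rule eq_matI)
  have c: "K * proj v * mat_adjoint K \<in> carrier_mat m m" "K *\<^sub>v v \<in> carrier_vec m"
    using assms by (auto intro: sandwich_carrier)
  then have c': "proj (K *\<^sub>v v) \<in> carrier_mat m m" by simp
  show "dim_row (K * proj v * mat_adjoint K) = dim_row (proj (K *\<^sub>v v))"
    "dim_col (K * proj v * mat_adjoint K) = dim_col (proj (K *\<^sub>v v))"
    unfolding carrier_matD[OF c(1)] carrier_matD[OF c'] by simp_all
  fix i j assume "i < dim_row (proj (K *\<^sub>v v))" "j < dim_col (proj (K *\<^sub>v v))"
  then have ij: "i < m" "j < m" using c' by auto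
  have "(K * proj v * mat_adjoint K) $$ (i, j) =
      (\<Sum>r<n. \<Sum>c<n. K $$ (i, r) * proj v $$ (r, c) * cnj (K $$ (j, c)))"
    using assms ij by (intro sandwich_index) auto
  also have "\<dots> = (\<Sum>r<n. \<Sum>c<n. (K $$ (i, r) * v $ r) * cnj (K $$ (j, c) * v $ c))"
    by (intro sum.cong refl) (simp add: proj_index[OF assms(2)])
  also have "\<dots> = (K *\<^sub>v v) $ i * cnj ((K *\<^sub>v v) $ j)"
    unfolding mult_mat_vec_index[OF assms ij(1)] mult_mat_vec_index[OF assms ij(2)] cnj_sum sum_product ..
  also have "\<dots> = proj (K *\<^sub>v v) $$ (i, j)"
    using proj_index[OF c(2) ij] by simp
  finally show "(K * proj v * mat_adjoint K) $$ (i, j) = proj (K *\<^sub>v v) $$ (i, j)" .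
qed

lemma kraus_map_proj:
  assumes "set Ks \<subseteq> carrier_mat d' d" "v \<in> carrier_vec d"
  shows "kraus_map d' Ks (proj v) = mat_sum d' (map (\<lambda>K. proj (K *\<^sub>v v)) Ks)"
  unfolding kraus_map_def
  using assms by (auto intro!: arg_cong[of _ _ "mat_sum d'"] simp: sandwich_proj[of _ d' d] subset_eq)

lemma mult_cnj_nonneg: "0 \<le> z * cnj z"
  by (simp add: less_eq_complex_def)

lemma psd_proj:
  assumes "v \<in> carrier_vec n"
  shows "psd n (proj v)"
proof -
  have "0 \<le> (proj v *\<^sub>v u) \<bullet>c u" if u: "u \<in> carrier_vec n" for u
  proof -
    have c: "proj v *\<^sub>v u \<in> carrier_vec n" by (rule mult_mat_vec_carrier[OF proj_carrier[OF assms] u])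
    have "(proj v *\<^sub>v u) \<bullet>c u = (\<Sum>i<n. (proj v *\<^sub>v u) $ i * cnj (u $ i))"
      using u c by (auto simp: scalar_prod_def atLeast0LessThan intro!: sum.cong)
    also have "\<dots> = (\<Sum>i<n. \<Sum>k<n. (v $ i * cnj (u $ i)) * cnj (v $ k * cnj (u $ k)))"
      by (intro sum.cong refl)
        (simp add: mult_mat_vec_index[OF proj_carrier[OF assms] u] proj_index[OF assms]
          sum_distrib_left sum_distrib_right mult_ac)
    also have "\<dots> = (\<Sum>i<n. v $ i * cnj (u $ i)) * cnj (\<Sum>i<n. v $ i * cnj (u $ i))"
      by (simp only: sum_product cnj_sum)
    also have "\<dots> \<ge> 0"
      by (rule mult_cnj_nonneg)
    finally show ?thesis .
  qed
  with assms show ?thesis by (simp add: psd_def)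
qed

lemma less_4_cases: "i < 4 \<Longrightarrow> i = 0 \<or> i = 1 \<or> i = 2 \<or> i = (3::nat)"
  by linarith

lemma phi_plus_carrier [simp]: "phi_plus \<in> carrier_vec 4"
  by (simp add: phi_plus_def ket2_def)

lemma phi_plus_index:
  "i < 4 \<Longrightarrow> phi_plus $ i = (if i = 0 \<or> i = 3 then complex_of_real (1 / sqrt 2) else 0)"
  by (auto simp: phi_plus_def ket2_def)

lemma sum_lessThan_4: "(\<Sum>i<4. f i) = f 0 + f 1 + f 2 + f (3::nat)"
  by (simp add: eval_nat_numeral)

lemma sum_lessThan_16: "(\<Sum>i<16. f i) = f 0 + f 1 + f 2 + f 3 + f 4 + f 5 + f 6 + f 7 + f 8 + f 9
    + f 10 + f 11 + f 12 + f 13 + f 14 + f (15::nat)"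
  by (simp add: eval_nat_numeral)

lemma half_sqrt2: "complex_of_real (1 / sqrt 2) * complex_of_real (1 / sqrt 2) = 1 / 2"
  by (simp flip: of_real_mult)

lemma phi_plus_expectation:
  assumes "M \<in> carrier_mat 4 4"
  shows "(M *\<^sub>v phi_plus) \<bullet>c phi_plus =
    (M $$ (0, 0) + M $$ (0, 3) + M $$ (3, 0) + M $$ (3, 3)) / 2"
proof -
  let ?s = "complex_of_real (1 / sqrt 2)"
  have "(M *\<^sub>v phi_plus) \<bullet>c phi_plus = (\<Sum>i<4. (M *\<^sub>v phi_plus) $ i * cnj (phi_plus $ i))"
    using carrier_vecD[OF phi_plus_carrier]
    by (auto simp: scalar_prod_def atLeast0LessThan intro!: sum.cong)
  also have "\<dots> = (M $$ (0, 0) + M $$ (0, 3) + M $$ (3, 0) + M $$ (3, 3)) * (?s * ?s)"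
    using mult_mat_vec_index[OF assms phi_plus_carrier]
    by (simp only: sum_lessThan_4) (simp add: sum_lessThan_4 phi_plus_index algebra_simps)
  finally show ?thesis by (simp only: half_sqrt2) simp
qed

lemma proj_phi_plus_index:
  assumes "i < 4" "j < 4"
  shows "proj phi_plus $$ (i, j) = (if i \<in> {0, 3} \<and> j \<in> {0, 3} then 1 / 2 else 0)"
  using assms half_sqrt2 by (simp add: proj_index[of _ 4] phi_plus_index)

lemma mtrace_proj_phi_plus [simp]: "mtrace (proj phi_plus) = 1"
proof -
  have "dim_row (proj phi_plus) = 4" using proj_carrier[OF phi_plus_carrier] by blast
  then show ?thesis by (simp add: mtrace_def sum_lessThan_4 proj_phi_plus_index)
qed

text \<open>
  The vector \<open>a|00,00\<rangle> + b(|01,01\<rangle> + |10,10\<rangle>) + c|11,11\<rangle>\<close>, where a state of two copies has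
  \<open>a = \<alpha>\<^sup>2\<close>, \<open>b = \<alpha>\<beta>\<close>, \<open>c = \<beta>\<^sup>2\<close>.
\<close>

definition two_copy_vec :: "complex \<Rightarrow> complex \<Rightarrow> complex \<Rightarrow> complex vec" where
  "two_copy_vec a b c = vec 16 (\<lambda>i. if i = 0 then a else if i = 5 \<or> i = 10 then b
     else if i = 15 then c else 0)"

lemma two_copy_vec_carrier [simp]: "two_copy_vec a b c \<in> carrier_vec 16"
  by (simp add: two_copy_vec_def)

text \<open>The positions 0, 5, 10, 15 are \<open>4 * x + x\<close> for \<open>x < 4\<close>: the
  two qubits agree in each copy of \<open>psi_S\<close>, so Alice's and Bob's two-bit labels
  coincide. The coefficients are kept independent because the bound is evaluated at (0, 1, 0), which
  no pair \<alpha>, \<beta> produces.\<close>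

lemma mult_two_copy_vec:
  assumes "K \<in> carrier_mat m 16" "i < m"
  shows "(K *\<^sub>v two_copy_vec a b c) $ i =
    a * K $$ (i, 0) + b * (K $$ (i, 5) + K $$ (i, 10)) + c * K $$ (i, 15)"
  unfolding mult_mat_vec_index[OF assms(1) two_copy_vec_carrier assms(2)] sum_lessThan_16
  by (simp add: two_copy_vec_def algebra_simps)

text \<open>The squared norm of |01,01> + |10,10>, which is the origin of the factor 2 in the
  optimal probability.\<close>

lemma mtrace_proj_two_copy_vec: "mtrace (proj (two_copy_vec 0 1 0)) = 2"
proof -
  have "dim_row (proj (two_copy_vec 0 1 0)) = 16"
    using proj_carrier[OF two_copy_vec_carrier] by blast
  then show ?thesis
    unfolding mtrace_def
    by (simp add: sum_lessThan_16 proj_index[OF two_copy_vec_carrier]) (simp add: two_copy_vec_def)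
qed

lemma psi_S_index:
  "i < 4 \<Longrightarrow> psi_S \<alpha> \<beta> $ i = (if i = 0 then \<alpha> else if i = 3 then \<beta> else 0)"
  by (auto simp: psi_S_def ket2_def)

lemma copy_index_less: "copy_index n k i < 4"
proof -
  have "bin_digit k x \<le> 1" for x by (auto simp: bin_digit_def)
  from this[of "i div 2 ^ n"] this[of "i mod 2 ^ n"] show ?thesis
    unfolding copy_index_def by linarith
qed

lemma copies_proj_psi_S:
  "copies 2 (proj (psi_S \<alpha> \<beta>)) = proj (two_copy_vec (\<alpha>\<^sup>2) (\<alpha> * \<beta>) (\<beta>\<^sup>2))"
proof (rule eq_matI)
  let ?v = "two_copy_vec (\<alpha>\<^sup>2) (\<alpha> * \<beta>) (\<beta>\<^sup>2)"
  have c: "psi_S \<alpha> \<beta> \<in> carrier_vec 4" by (simp add: psi_S_def ket2_def)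
  \<comment> \<open>Since \<open>copies\<close> multiplies entries of rank-one projectors, it
    suffices to compare amplitudes, which is a check of 16 positions.\<close>
  have *: "psi_S \<alpha> \<beta> $ copy_index 2 0 i * psi_S \<alpha> \<beta> $ copy_index 2 1 i = ?v $ i" if "i < 16" for i
  proof -
    have "i \<in> {0, 1, 2, 3, 4, 5, 6, 7, 8, 9, 10, 11, 12, 13, 14, 15}"
      using that by (auto simp: eval_nat_numeral less_Suc_eq)
    then show ?thesis
      unfolding psi_S_index[OF copy_index_less]
      by (elim insertE emptyE) (simp_all add: two_copy_vec_def copy_index_def bin_digit_def power2_eq_square)
  qed
  fix i j assume "i < dim_row (proj ?v)" "j < dim_col (proj ?v)"
  then have ij: "i < 16" "j < 16" using carrier_vecD[OF two_copy_vec_carrier] by (auto simp: proj_def)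
  have "copies 2 (proj (psi_S \<alpha> \<beta>)) $$ (i, j) =
      proj (psi_S \<alpha> \<beta>) $$ (copy_index 2 0 i, copy_index 2 0 j) *
      proj (psi_S \<alpha> \<beta>) $$ (copy_index 2 1 i, copy_index 2 1 j)"
    using ij by (simp add: copies_def numeral_2_eq_2)
  also have "\<dots> = ?v $ i * cnj (?v $ j)"
    by (simp add: proj_index[OF c] copy_index_less flip: *[OF ij(1)] *[OF ij(2)])
  also have "\<dots> = proj ?v $$ (i, j)"
    using ij by (simp add: proj_index[of _ 16])
  finally show "copies 2 (proj (psi_S \<alpha> \<beta>)) $$ (i, j) = proj ?v $$ (i, j)" .
qed (simp_all add: copies_def proj_def two_copy_vec_def)

section \<open>Conclusive protocols\<close>

text \<open>
  \<open>Tr M - \<langle>\<phi>\<^sup>+|M|\<phi>\<^sup>+\<rangle>\<close>, the weight of \<open>M\<close> outside \<open>\<phi>\<^sup>+\<close>.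
\<close>

definition defect :: "complex mat \<Rightarrow> complex" where
  "defect M = M $$ (1, 1) + M $$ (2, 2)
     + (M $$ (0, 0) - M $$ (0, 3) - M $$ (3, 0) + M $$ (3, 3)) / 2"

lemma conclusive_iff_defect:
  assumes "M \<in> carrier_mat 4 4"
  shows "(M *\<^sub>v phi_plus) \<bullet>c phi_plus = mtrace M \<longleftrightarrow> defect M = 0"
proof -
  have "mtrace M = M $$ (0, 0) + M $$ (1, 1) + M $$ (2, 2) + M $$ (3, 3)"
    using assms by (simp add: mtrace_def sum_lessThan_4)
  then have "mtrace M - (M *\<^sub>v phi_plus) \<bullet>c phi_plus = defect M"
    by (simp add: phi_plus_expectation[OF assms] defect_def field_simps)
  then show ?thesis by auto
qed

text \<open>The three terms are the squared components of \<open>u\<close> along |01>, |10> and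
  (|00> - |11>)/sqrt 2, an orthonormal basis of the complement of phi+.\<close>

lemma defect_proj:
  assumes "u \<in> carrier_vec 4"
  shows "defect (proj u) =
    complex_of_real ((cmod (u $ 1))\<^sup>2 + (cmod (u $ 2))\<^sup>2 + (cmod (u $ 0 - u $ 3))\<^sup>2 / 2)"
  unfolding of_real_add of_real_divide complex_norm_square
  using assms by (simp add: defect_def proj_index[of _ 4] algebra_simps)

lemma defect_mat_sum:
  "set Ms \<subseteq> carrier_mat 4 4 \<Longrightarrow> defect (mat_sum 4 Ms) = (\<Sum>M\<leftarrow>Ms. defect M)"
  by (rule mat_sum_additive) (auto simp: defect_def add_divide_distrib diff_divide_distrib)

text \<open>The defect of the output is the sum of the defects of the vectors
  \<open>L *\<^sub>v v\<close>. These are nonnegative, so a vanishing total forces each of them to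
  vanish, and \<open>K *\<^sub>v v\<close> is a multiple of |00> + |11>.\<close>

lemma conclusive_kraus:
  assumes Ks: "set Ks \<subseteq> carrier_mat 4 d" and v: "v \<in> carrier_vec d"
    and "defect (kraus_map 4 Ks (proj v)) = 0" and K: "K \<in> set Ks"
  shows "(K *\<^sub>v v) $ 1 = 0" "(K *\<^sub>v v) $ 2 = 0" "(K *\<^sub>v v) $ 3 = (K *\<^sub>v v) $ 0"
proof -
  \<comment> \<open>A real-valued form of the defect, so that the argument on nonnegative terms with
    sum zero runs over the reals.\<close>
  define f where "f u = (cmod (u $ 1))\<^sup>2 + (cmod (u $ 2))\<^sup>2 + (cmod (u $ 0 - u $ 3))\<^sup>2 / 2"
    for u :: "complex vec"
  have f_nonneg: "f u \<ge> 0" for u by (simp add: f_def)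
  have Kv: "L *\<^sub>v v \<in> carrier_vec 4" if "L \<in> set Ks" for L
    using that Ks v mult_mat_vec_carrier by blast
  have "set (map (\<lambda>L. proj (L *\<^sub>v v)) Ks) \<subseteq> carrier_mat 4 4"
    using Kv proj_carrier by auto
  then have "(\<Sum>L\<leftarrow>Ks. defect (proj (L *\<^sub>v v))) = defect (kraus_map 4 Ks (proj v))"
    unfolding kraus_map_proj[OF Ks v] by (simp only: defect_mat_sum map_map o_def)
  moreover have "(\<Sum>L\<leftarrow>Ks. defect (proj (L *\<^sub>v v))) = (\<Sum>L\<leftarrow>Ks. complex_of_real (f (L *\<^sub>v v)))"
    unfolding f_def by (intro arg_cong[of _ _ sum_list] map_cong refl defect_proj Kv)
  moreover have "\<dots> = complex_of_real (\<Sum>L\<leftarrow>Ks. f (L *\<^sub>v v))"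
    by (induction Ks) simp_all
  ultimately have "(\<Sum>L\<leftarrow>Ks. f (L *\<^sub>v v)) = 0"
    using assms(3) by (simp only: of_real_eq_0_iff)
  then have "\<forall>x \<in> set (map (\<lambda>L. f (L *\<^sub>v v)) Ks). x = 0"
    using sum_list_nonneg_eq_0_iff[of "map (\<lambda>L. f (L *\<^sub>v v)) Ks"] f_nonneg by auto
  then have "f (K *\<^sub>v v) = 0" using K by simp
  then have "(cmod ((K *\<^sub>v v) $ 1))\<^sup>2 = 0 \<and> (cmod ((K *\<^sub>v v) $ 2))\<^sup>2 = 0 \<and>
      (cmod ((K *\<^sub>v v) $ 0 - (K *\<^sub>v v) $ 3))\<^sup>2 = 0"
    unfolding f_def by (smt (verit) zero_le_power2 divide_nonneg_pos half_gt_zero)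
  then show "(K *\<^sub>v v) $ 1 = 0" "(K *\<^sub>v v) $ 2 = 0" "(K *\<^sub>v v) $ 3 = (K *\<^sub>v v) $ 0"
    by (simp_all only: power_eq_0_iff norm_eq_zero) simp
qed

text \<open>
  A product operator sends a product vector to a product vector, and the only one proportional to
  \<open>\<phi>\<^sup>+\<close> is zero.
\<close>

lemma product_column_eq_0:
  fixes x y :: "nat \<Rightarrow> complex"
  assumes "x 0 * y 1 = 0" "x 1 * y 0 = 0" "x 1 * y 1 = x 0 * y 0" "i < 2" "j < 2"
  shows "x i * y j = 0"
proof -
  have "i = 0 \<or> i = 1" "j = 0 \<or> j = 1" using assms by auto
  with assms show ?thesis by auto
qed

text \<open>Three states suffice: |00>, |11> and their equal superposition. Their constraints fix
  the columns 0 and 15 of every \<open>K\<close> and the sum of the columns 5 and 10, and linearity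
  extends this to all \<open>a\<close>, \<open>b\<close>, \<open>c\<close>.\<close>

lemma conclusive_form:
  assumes sep: "separable 2 2 4 4 E"
    and conc: "\<And>\<rho>. \<rho> \<in> S2 \<Longrightarrow>
      (E (copies 2 \<rho>) *\<^sub>v phi_plus) \<bullet>c phi_plus = mtrace (E (copies 2 \<rho>))"
  obtains p :: real where
    "\<And>a b c. E (proj (two_copy_vec a b c)) = complex_of_real (2 * p * (cmod b)\<^sup>2) \<cdot>\<^sub>m proj phi_plus"
proof -
  obtain Ps where Ps: "set Ps \<subseteq> carrier_mat 2 4 \<times> carrier_mat 2 4"
    "\<And>X. X \<in> carrier_mat 16 16 \<Longrightarrow> E X = kraus_map 4 (map (\<lambda>(A, B). kron A B) Ps) X"
    using sep unfolding separable_def by auto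
  define Ks where "Ks = map (\<lambda>(A, B). kron A B) Ps"
  have Ks: "set Ks \<subseteq> carrier_mat 4 16"
    using product_kraus_set[OF Ps(1)] by (simp add: Ks_def)
  have E: "E (proj (two_copy_vec a b c)) = kraus_map 4 Ks (proj (two_copy_vec a b c))" for a b c
    unfolding Ks_def by (intro Ps(2) proj_carrier two_copy_vec_carrier)
  have defect: "defect (kraus_map 4 Ks (proj (two_copy_vec (\<alpha>\<^sup>2) (\<alpha> * \<beta>) (\<beta>\<^sup>2)))) = 0"
    if "(cmod \<alpha>)\<^sup>2 + (cmod \<beta>)\<^sup>2 = 1" for \<alpha> \<beta>
  proof -
    have "proj (psi_S \<alpha> \<beta>) \<in> S2" using that by (auto simp: S2_def)
    from conc[OF this] show ?thesis
      unfolding copies_proj_psi_S E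
      by (subst (asm) conclusive_iff_defect) (auto intro: kraus_map_carrier[OF Ks])
  qed
  have col: "K $$ (i, 0) = 0 \<and> K $$ (i, 15) = 0" if K: "K \<in> set Ks" and i: "i < 4" for K i
  proof -
    obtain A B where AB: "K = kron A B" "A \<in> carrier_mat 2 4" "B \<in> carrier_mat 2 4"
      using K Ps(1) by (auto simp: Ks_def)
    have ix: "K $$ (k, j) = A $$ (k div 2, j div 4) * B $$ (k mod 2, j mod 4)"
      if "k < 4" "j < 16" for k j
      using that AB by (simp add: kron_index)
    have K': "K \<in> carrier_mat 4 16" using K Ks by auto
    note c = conclusive_kraus[OF Ks two_copy_vec_carrier defect K]
    have i2: "i div 2 < 2" "i mod 2 < 2" using i by auto
    \<comment> \<open>The instances (1, 0) and (0, 1) of (\<alpha>, \<beta>) isolate the columns 0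
      and 15. By the product form these are Kronecker products of the local columns 0 and 3
      respectively, as 15 = 4 * 3 + 3.\<close>
    have "K $$ (i, 0) = 0"
      using c[of 1 0] product_column_eq_0[of "\<lambda>x. A $$ (x, 0)" "\<lambda>y. B $$ (y, 0)", OF _ _ _ i2] i
      by (simp add: mult_two_copy_vec[OF K'] ix)
    moreover have "K $$ (i, 15) = 0"
      using c[of 0 1] product_column_eq_0[of "\<lambda>x. A $$ (x, 3)" "\<lambda>y. B $$ (y, 3)", OF _ _ _ i2] i
      by (simp add: mult_two_copy_vec[OF K'] ix)
    ultimately show ?thesis ..
  qed
  \<comment> \<open>The amplitude on |00> of the image of |01,01> + |10,10> under \<open>K\<close>;
    it turns out to be the amplitude on |11> as well.\<close>
  define g where "g K = K $$ (0, 5) + K $$ (0, 10)" for K :: "complex mat"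
  have Kv: "(K *\<^sub>v two_copy_vec a b c) $ i = (if i \<in> {0, 3} then b * g K else 0)"
    if K: "K \<in> set Ks" and i: "i < 4" for K i a b c
  proof -
    have K': "K \<in> carrier_mat 4 16" using K Ks by auto
    have lin: "(K *\<^sub>v two_copy_vec a b c) $ j = b * (K $$ (j, 5) + K $$ (j, 10))" if "j < 4" for a b c j
      using col[OF K that] that by (simp add: mult_two_copy_vec[OF K'])
    \<comment> \<open>With the outer columns gone, a single state with nonzero \<alpha>\<beta>
      determines the remaining constraint; the equal superposition has \<alpha>\<beta> =
      1/2.\<close>
    let ?s = "complex_of_real (1 / sqrt 2)"
    have "(cmod ?s)\<^sup>2 + (cmod ?s)\<^sup>2 = 1" by (simp add: power_divide norm_divide)
    note c = conclusive_kraus[OF Ks two_copy_vec_carrier defect[OF this] K]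
    have "K $$ (1, 5) + K $$ (1, 10) = 0" "K $$ (2, 5) + K $$ (2, 10) = 0"
      "K $$ (3, 5) + K $$ (3, 10) = g K"
      using c by (simp_all add: lin g_def)
    with less_4_cases[OF i] show ?thesis
      by (auto simp: lin g_def)
  qed
  \<comment> \<open>Each \<open>K\<close> yields \<open>b * g K\<close> times |00> + |11>, a vector
    of squared norm 2; this is the 2 in front of \<open>p\<close>.\<close>
  define p where "p = (\<Sum>K\<leftarrow>Ks. (cmod (g K))\<^sup>2)"
  have "E (proj (two_copy_vec a b c)) = complex_of_real (2 * p * (cmod b)\<^sup>2) \<cdot>\<^sub>m proj phi_plus" for a b c
  proof (rule eq_matI)
    let ?v = "two_copy_vec a b c"
    have cE: "E (proj ?v) \<in> carrier_mat 4 4"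
      unfolding E by (intro kraus_map_carrier[OF Ks]) simp
    have cp: "proj phi_plus \<in> carrier_mat 4 4" by simp
    show "dim_row (E (proj ?v)) = dim_row (complex_of_real (2 * p * (cmod b)\<^sup>2) \<cdot>\<^sub>m proj phi_plus)"
      "dim_col (E (proj ?v)) = dim_col (complex_of_real (2 * p * (cmod b)\<^sup>2) \<cdot>\<^sub>m proj phi_plus)"
      using carrier_matD[OF cE] carrier_matD[OF cp] by simp_all
    fix i j assume "i < dim_row (complex_of_real (2 * p * (cmod b)\<^sup>2) \<cdot>\<^sub>m proj phi_plus)"
      "j < dim_col (complex_of_real (2 * p * (cmod b)\<^sup>2) \<cdot>\<^sub>m proj phi_plus)"
    then have ij: "i < 4" "j < 4" using carrier_matD[OF cp] by simp_all
    have cKv: "K *\<^sub>v ?v \<in> carrier_vec 4" if "K \<in> set Ks" for K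
      using that Ks two_copy_vec_carrier by (metis mult_mat_vec_carrier subset_iff)
    have "E (proj ?v) $$ (i, j) = (\<Sum>K\<leftarrow>Ks. proj (K *\<^sub>v ?v) $$ (i, j))"
      unfolding E kraus_map_proj[OF Ks two_copy_vec_carrier]
      by (subst mat_sum_index) (use ij cKv in \<open>auto simp: o_def\<close>)
    also have "\<dots> = (\<Sum>K\<leftarrow>Ks. complex_of_real ((cmod (g K))\<^sup>2) *
        (complex_of_real (2 * (cmod b)\<^sup>2) * proj phi_plus $$ (i, j)))"
    proof (intro arg_cong[of _ _ sum_list] map_cong refl)
      fix K assume K: "K \<in> set Ks"
      have "of_real ((cmod b)\<^sup>2) = b * cnj b" "of_real ((cmod (g K))\<^sup>2) = g K * cnj (g K)"
        by (rule complex_norm_square)+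
      then show "proj (K *\<^sub>v ?v) $$ (i, j) = complex_of_real ((cmod (g K))\<^sup>2) *
          (complex_of_real (2 * (cmod b)\<^sup>2) * proj phi_plus $$ (i, j))"
        using ij by (simp add: proj_index[OF cKv[OF K]] Kv[OF K] proj_phi_plus_index)
    qed
    also have "\<dots> = complex_of_real p * (complex_of_real (2 * (cmod b)\<^sup>2) * proj phi_plus $$ (i, j))"
      unfolding p_def by (induction Ks) (simp_all add: distrib_right)
    finally show "E (proj ?v) $$ (i, j) =
        (complex_of_real (2 * p * (cmod b)\<^sup>2) \<cdot>\<^sub>m proj phi_plus) $$ (i, j)"
      using ij carrier_matD[OF cp] by simp
  qed
  then show ?thesis by (rule that)
qed

lemma complex_of_real_le_iff: "complex_of_real x \<le> complex_of_real y \<longleftrightarrow> x \<le> y"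
  by (simp add: less_eq_complex_def)

lemma mtrace_smult_phi_plus: "mtrace (c \<cdot>\<^sub>m proj phi_plus) = c"
  by (subst mtrace_smult[of _ 4]) simp_all

text \<open>All freedom of a conclusive protocol on these inputs lies in one number
  \<open>p\<close>, common to all \<alpha> and \<beta>.\<close>

lemma ECP_form:
  assumes "universal_conclusive_ECP S2 2 E"
  obtains p :: real where "p \<le> 1"
    "\<And>\<alpha> \<beta>. E (copies 2 (proj (psi_S \<alpha> \<beta>))) =
      complex_of_real (2 * p * (cmod (\<alpha> * \<beta>))\<^sup>2) \<cdot>\<^sub>m proj phi_plus"
proof -
  obtain E2 where E2: "locc_pair 4 4 2 2 E E2" "trace_nonincreasing 16 E"
    and conc: "\<And>\<rho>. \<rho> \<in> S2 \<Longrightarrow>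
      (E (copies 2 \<rho>) *\<^sub>v phi_plus) \<bullet>c phi_plus = mtrace (E (copies 2 \<rho>))"
    using assms unfolding universal_conclusive_ECP_def by auto
  obtain p where p: "\<And>a b c. E (proj (two_copy_vec a b c)) =
      complex_of_real (2 * p * (cmod b)\<^sup>2) \<cdot>\<^sub>m proj phi_plus"
    using conclusive_form[OF locc_pair_separable(1)[OF E2(1)] conc] by blast
  \<comment> \<open>Here the input has no weight on |00,00> and |11,11>, where it would be lost, so
    trace monotonicity reads 2p \<le> 2.\<close>
  have "mtrace (E (proj (two_copy_vec 0 1 0))) \<le> mtrace (proj (two_copy_vec 0 1 0))"
    using E2(2) psd_proj[OF two_copy_vec_carrier] by (simp add: trace_nonincreasing_def)
  then have "complex_of_real (2 * p) \<le> complex_of_real 2"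
    by (simp add: p mtrace_smult_phi_plus mtrace_proj_two_copy_vec)
  then have "p \<le> 1" by (simp only: complex_of_real_le_iff)
  then show ?thesis by (rule that) (simp only: copies_proj_psi_S p)
qed

section \<open>The parity protocol\<close>

text \<open>
  Each party measures the parity of their two qubits; \<open>odd_kraus\<close> and \<open>even_kraus\<close> relabel the
  basis of the two-dimensional subspace found as that of a qubit. The outcome \<open>odd\<close> on both sides
  is a success.
\<close>

definition odd_kraus :: "complex mat" where
  "odd_kraus = mat 2 4 (\<lambda>(i, j). if j = i + 1 then 1 else 0)"

definition even_kraus :: "complex mat" where
  "even_kraus = mat 2 4 (\<lambda>(i, j). if j = 3 * i then 1 else 0)"

lemma odd_kraus_index: "i < 2 \<Longrightarrow> j < 4 \<Longrightarrow> odd_kraus $$ (i, j) = (if j = i + 1 then 1 else 0)"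
  by (simp add: odd_kraus_def)

definition parity_ops :: "(nat \<times> complex mat list) list" where
  "parity_ops = [(2, [odd_kraus]), (2, [even_kraus])]"

lemma parity_kraus_carrier [simp]:
  "odd_kraus \<in> carrier_mat 2 4" "even_kraus \<in> carrier_mat 2 4"
  by (simp_all add: odd_kraus_def even_kraus_def)

text \<open>The labels {1, 2} and {0, 3} partition the four basis labels, so the two effects are
  complementary projectors.\<close>

lemma local_instrument_parity_ops: "local_instrument 4 parity_ops"
proof -
  have c: "mat_adjoint odd_kraus * odd_kraus \<in> carrier_mat 4 4"
    "mat_adjoint even_kraus * even_kraus \<in> carrier_mat 4 4"
    by (meson parity_kraus_carrier mat_adjoint_carrier mult_carrier_mat)+
  have "mat_adjoint odd_kraus * odd_kraus + mat_adjoint even_kraus * even_kraus = 1\<^sub>m 4"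
  proof (rule eq_matI)
    fix i j assume "i < dim_row (1\<^sub>m 4 :: complex mat)" "j < dim_col (1\<^sub>m 4 :: complex mat)"
    then have ij: "i < 4" "j < 4" by auto
    have "(mat_adjoint K * K) $$ (i, j) = cnj (K $$ (0, i)) * K $$ (0, j) + cnj (K $$ (1, i)) * K $$ (1, j)"
      if K: "K \<in> carrier_mat 2 4" for K
      unfolding mult_mat_index[OF mat_adjoint_carrier[OF K] K ij]
      using ij by (simp add: mat_adjoint_index[OF K] numeral_2_eq_2)
    then have "(mat_adjoint odd_kraus * odd_kraus) $$ (i, j) + (mat_adjoint even_kraus * even_kraus) $$ (i, j)
        = (1\<^sub>m 4 :: complex mat) $$ (i, j)"
      using ij less_4_cases[OF ij(1)] less_4_cases[OF ij(2)]
      by (auto simp: odd_kraus_def even_kraus_def)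
    then show "(mat_adjoint odd_kraus * odd_kraus + mat_adjoint even_kraus * even_kraus) $$ (i, j)
        = 1\<^sub>m 4 $$ (i, j)"
      using ij carrier_matD[OF c(2)] by simp
  qed (use carrier_matD[OF c(2)] in simp_all)
  then show ?thesis
    using right_add_zero_mat[OF c(2)] by (simp add: local_instrument_def parity_ops_def)
qed

lemma parity_protocol:
  obtains E E2 where "locc_pair 4 4 2 2 E E2"
    "\<And>X. X \<in> carrier_mat 16 16 \<Longrightarrow> E X = kraus_map 4 [kron odd_kraus odd_kraus] X"
proof -
  \<comment> \<open>Bob's round, after Alice's side has shrunk to one qubit. It is the continuation
    for both of her outcomes, as he measures the same parity in either case.\<close>
  define Gs where "Gs = concat (map (\<lambda>((d, Ks), Fs).
      map (\<lambda>F X. F (kraus_map (2 * d) (map (\<lambda>K. kron (1\<^sub>m 2) K) Ks) X)) Fs)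
      (zip parity_ops [[\<lambda>X. X], [\<lambda>X. X]]))"
  define Fs where "Fs = concat (map (\<lambda>((d, Ks), Fs).
      map (\<lambda>F X. F (kraus_map (d * 4) (map (\<lambda>K. kron K (1\<^sub>m 4)) Ks) X)) Fs)
      (zip parity_ops [Gs, Gs]))"
  define E where "E J X = mat_sum (2 * 2) (map (\<lambda>F. F X) (nths Fs J))" for J X
  have "locc_instrument 2 2 2 4 Gs"
    unfolding Gs_def
    by (rule locc_instrument.bob[OF local_instrument_parity_ops])
      (simp add: parity_ops_def locc_instrument.finish)
  then have "locc_instrument 2 2 4 4 Fs"
    unfolding Fs_def
    by (intro locc_instrument.alice[OF local_instrument_parity_ops]) (simp add: parity_ops_def)
  \<comment> \<open>\<open>parity_ops\<close> lists the odd outcome first, so position 0 is the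
    transcript with odd parity on both sides.\<close>
  then have "locc_pair 4 4 2 2 (E {0}) (E (- {0}))"
    unfolding locc_pair_def E_def by blast
  moreover have "E {0} X = kraus_map 4 [kron odd_kraus odd_kraus] X" if X: "X \<in> carrier_mat 16 16" for X
  proof -
    let ?A = "kron odd_kraus (1\<^sub>m 4)" and ?B = "kron (1\<^sub>m 2) odd_kraus"
    have A: "set [?A] \<subseteq> carrier_mat 8 16" and B: "set [?B] \<subseteq> carrier_mat 4 8"
      using kron_carrier[OF parity_kraus_carrier(1) one_carrier_mat[of 4]]
        kron_carrier[OF one_carrier_mat[of 2] parity_kraus_carrier(1)] by auto
    have "kraus_map 4 [?B] (kraus_map 8 [?A] X) \<in> carrier_mat 4 4"
      by (intro kraus_map_carrier[OF B] kraus_map_carrier[OF A X])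
    then have "E {0} X = kraus_map 4 [?B] (kraus_map 8 [?A] X)"
      by (simp add: E_def Fs_def Gs_def parity_ops_def nths_Cons del: kraus_map_Cons)
    also have "\<dots> = kraus_map 4 [?B * ?A] X"
      using kraus_map_comp[OF B A X] by (simp del: kraus_map_Cons)
    also have "?B * ?A = kron odd_kraus odd_kraus"
      using kron_mult[OF one_carrier_mat parity_kraus_carrier(1) parity_kraus_carrier(1) one_carrier_mat]
      by (simp add: left_mult_one_mat[OF parity_kraus_carrier(1)] right_mult_one_mat[OF parity_kraus_carrier(1)])
    finally show ?thesis .
  qed
  ultimately show ?thesis by (rule that)
qed

text \<open>The protocol works without knowledge of the state because |01,01> and |10,10> carry the
  same amplitude \<alpha>\<beta> for all \<alpha>, \<beta>: projected and relabelled, the state is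
  \<alpha>\<beta> (|00> + |11>).\<close>

lemma parity_ECP:
  obtains E where "universal_conclusive_ECP S2 2 E"
    "\<And>\<alpha> \<beta>. mtrace (E (copies 2 (proj (psi_S \<alpha> \<beta>)))) = complex_of_real (2 * (cmod (\<alpha> * \<beta>))\<^sup>2)"
proof -
  obtain E E2 where E: "locc_pair 4 4 2 2 E E2"
    "\<And>X. X \<in> carrier_mat 16 16 \<Longrightarrow> E X = kraus_map 4 [kron odd_kraus odd_kraus] X"
    using parity_protocol by blast
  let ?K = "kron odd_kraus odd_kraus"
  have K: "?K \<in> carrier_mat 4 16"
    using kron_carrier[OF parity_kraus_carrier(1) parity_kraus_carrier(1)] by simp
  define u where "u a b c = ?K *\<^sub>v two_copy_vec a b c" for a b c
  have u: "u a b c \<in> carrier_vec 4" for a b c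
    unfolding u_def using K by auto
  have ui: "u a b c $ i = (if i \<in> {0, 3} then b else 0)" if "i < 4" for i a b c
  proof -
    have "?K $$ (i, j) = odd_kraus $$ (i div 2, j div 4) * odd_kraus $$ (i mod 2, j mod 4)"
      if "i < 4" "j < 16" for i j
      using that by (intro kron_index[OF parity_kraus_carrier(1) parity_kraus_carrier(1)]) simp_all
    with less_4_cases[OF that] show ?thesis
      by (elim disjE) (simp_all add: u_def mult_two_copy_vec[OF K] odd_kraus_index)
  qed
  have Eu: "E (proj (two_copy_vec a b c)) = proj (u a b c)" for a b c
    using E(2)[OF proj_carrier[OF two_copy_vec_carrier]] K right_add_zero_mat[OF proj_carrier[OF u]]
    by (simp add: sandwich_proj[OF K two_copy_vec_carrier] u_def)
  have conc: "(E (copies 2 \<rho>) *\<^sub>v phi_plus) \<bullet>c phi_plus = mtrace (E (copies 2 \<rho>))"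
    if S: "\<rho> \<in> S2" for \<rho>
  proof -
    obtain \<alpha> \<beta> where \<rho>: "\<rho> = proj (psi_S \<alpha> \<beta>)" using S by (auto simp: S2_def)
    show ?thesis
      unfolding \<rho> copies_proj_psi_S Eu conclusive_iff_defect[OF proj_carrier[OF u]] defect_proj[OF u]
      by (simp add: ui)
  qed
  have "universal_conclusive_ECP S2 2 E"
    using E(1) conc separable_completely_positive[OF locc_pair_separable(1)[OF E(1)]]
      separable_completely_positive[OF locc_pair_separable(2)[OF E(1)]]
      locc_pair_separable(3)[OF E(1)] locc_pair_trace_nonincreasing[OF E(1)]
    unfolding universal_conclusive_ECP_def by auto
  moreover have "mtrace (E (copies 2 (proj (psi_S \<alpha> \<beta>)))) = complex_of_real (2 * (cmod (\<alpha> * \<beta>))\<^sup>2)" for \<alpha> \<beta>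
  proof -
    have "complex_of_real ((cmod (\<alpha> * \<beta>))\<^sup>2) = (\<alpha> * \<beta>) * cnj (\<alpha> * \<beta>)"
      by (rule complex_norm_square)
    then show ?thesis
      using carrier_matD[OF proj_carrier[OF u]]
      by (simp add: copies_proj_psi_S Eu mtrace_def sum_lessThan_4 proj_index[OF u] ui)
  qed
  ultimately show ?thesis by (rule that)
qed

section \<open>Comparison of all conclusive protocols with the parity protocol\<close>

text \<open>The existence of an optimal map keeps the universally quantified part from being
  vacuous. For an arbitrary optimal map the value follows from comparison with the parity protocol
  in both directions.\<close>

theorem theorem1:
  shows "(\<exists>E. optimal_universal_conclusive_ECP S2 2 E) \<and>
    (\<forall>E. optimal_universal_conclusive_ECP S2 2 E \<longrightarrow>
      (\<forall>\<alpha> \<beta>. (cmod \<alpha>)\<^sup>2 + (cmod \<beta>)\<^sup>2 = 1 \<longrightarrow>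
        E (copies 2 (proj (psi_S \<alpha> \<beta>))) =
          complex_of_real (2 * (cmod (\<alpha> * \<beta>))\<^sup>2) \<cdot>\<^sub>m proj phi_plus \<and>
        mtrace (E (copies 2 (proj (psi_S \<alpha> \<beta>)))) = complex_of_real (2 * (cmod (\<alpha> * \<beta>))\<^sup>2)))"
proof -
  obtain E\<^sub>0 where E\<^sub>0: "universal_conclusive_ECP S2 2 E\<^sub>0"
    "\<And>\<alpha> \<beta>. mtrace (E\<^sub>0 (copies 2 (proj (psi_S \<alpha> \<beta>)))) = complex_of_real (2 * (cmod (\<alpha> * \<beta>))\<^sup>2)"
    by (rule parity_ECP) (rule that)
  have bound: "mtrace (E (copies 2 \<rho>)) \<le> mtrace (E\<^sub>0 (copies 2 \<rho>))"
    if ECP: "universal_conclusive_ECP S2 2 E" and S: "\<rho> \<in> S2" for E \<rho>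
  proof -
    obtain \<alpha> \<beta> where \<rho>: "\<rho> = proj (psi_S \<alpha> \<beta>)" using S by (auto simp: S2_def)
    obtain p where p: "p \<le> 1" "E (copies 2 (proj (psi_S \<alpha> \<beta>))) =
        complex_of_real (2 * p * (cmod (\<alpha> * \<beta>))\<^sup>2) \<cdot>\<^sub>m proj phi_plus"
      by (rule ECP_form[OF ECP]) (rule that)
    have "2 * p * (cmod (\<alpha> * \<beta>))\<^sup>2 \<le> 2 * (cmod (\<alpha> * \<beta>))\<^sup>2"
      using p(1) by (intro mult_right_mono) auto
    then show ?thesis
      unfolding \<rho> p(2) mtrace_smult_phi_plus E\<^sub>0(2) by (simp only: complex_of_real_le_iff)
  qed
  have "optimal_universal_conclusive_ECP S2 2 E\<^sub>0"
    unfolding optimal_universal_conclusive_ECP_def using E\<^sub>0(1) bound by blast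
  moreover have form: "E (copies 2 (proj (psi_S \<alpha> \<beta>))) =
        complex_of_real (2 * (cmod (\<alpha> * \<beta>))\<^sup>2) \<cdot>\<^sub>m proj phi_plus"
    if opt: "optimal_universal_conclusive_ECP S2 2 E" and norm: "(cmod \<alpha>)\<^sup>2 + (cmod \<beta>)\<^sup>2 = 1"
    for E \<alpha> \<beta>
  proof -
    have ECP: "universal_conclusive_ECP S2 2 E"
      using opt unfolding optimal_universal_conclusive_ECP_def by blast
    have S: "proj (psi_S \<alpha> \<beta>) \<in> S2" using norm by (auto simp: S2_def)
    obtain p where p: "E (copies 2 (proj (psi_S \<alpha> \<beta>))) =
        complex_of_real (2 * p * (cmod (\<alpha> * \<beta>))\<^sup>2) \<cdot>\<^sub>m proj phi_plus"
      by (rule ECP_form[OF ECP]) (rule that)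
    have "mtrace (E\<^sub>0 (copies 2 (proj (psi_S \<alpha> \<beta>)))) \<le> mtrace (E (copies 2 (proj (psi_S \<alpha> \<beta>))))"
      using opt E\<^sub>0(1) S unfolding optimal_universal_conclusive_ECP_def by blast
    then have "mtrace (E (copies 2 (proj (psi_S \<alpha> \<beta>)))) = complex_of_real (2 * (cmod (\<alpha> * \<beta>))\<^sup>2)"
      using bound[OF ECP S] unfolding E\<^sub>0(2) by (intro order.antisym)
    \<comment> \<open>Only the product of \<open>p\<close> with the squared modulus of
      \<alpha>\<beta> is identified, which also covers \<alpha>\<beta> = 0, where the trace says
      nothing about \<open>p\<close>.\<close>
    then have "complex_of_real (2 * p * (cmod (\<alpha> * \<beta>))\<^sup>2) = complex_of_real (2 * (cmod (\<alpha> * \<beta>))\<^sup>2)"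
      unfolding p mtrace_smult_phi_plus .
    then show ?thesis unfolding p by (rule arg_cong)
  qed
  moreover have "mtrace (E (copies 2 (proj (psi_S \<alpha> \<beta>)))) = complex_of_real (2 * (cmod (\<alpha> * \<beta>))\<^sup>2)"
    if "optimal_universal_conclusive_ECP S2 2 E" "(cmod \<alpha>)\<^sup>2 + (cmod \<beta>)\<^sup>2 = 1" for E \<alpha> \<beta>
    unfolding form[OF that] by (rule mtrace_smult_phi_plus)
  ultimately show ?thesis by blast
qed

end
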